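(* For every integer $n\geq 4$, there is a non-simple $n$-Venn diagram whose graph has an even number of vertices and no perfect matching, and hence no Hamilton cycle.
   Context: An $n$-Venn diagram is a collection of $n$ simple closed curves in the plane that intersect in only finitely many points and create exactly $2^n$ regions, one for every possible combination of being inside or outside of each of the $n$ curves. It is simple if at most two of the $n$ curves intersect in any point, and non-simple otherwise. The graph of a Venn diagram is the plane (multi)graph whose vertices are the crossings (intersection points) of the curves and whose edges are the curve segments between consecutive crossings; it may have multiple edges. A Hamilton cycle is a cycle visiting every vertex exactly once. *)

theory Defs
  imports "HOL-Analysis.Analysis"
begin

section \<open>Undirected multigraphs\<close>

text \<open>
  \<open>ends G e\<close> is the set of endpoints of the edge \<open>e\<close>: a two-element set for an ordinary edge,
  a singleton for a loop. Distinct edges may have the same endpoints.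
\<close>

record ('v, 'e) multigraph =
  verts :: "'v set"
  edges :: "'e set"
  ends :: "'e \<Rightarrow> 'v set"

text \<open>Loops are never part of a matching.\<close>

definition matching :: "('v, 'e) multigraph \<Rightarrow> 'e set \<Rightarrow> bool" where
  "matching G M \<longleftrightarrow>
     M \<subseteq> edges G \<and> (\<forall>e\<in>M. card (ends G e) = 2) \<and>
     (\<forall>e\<in>M. \<forall>f\<in>M. e \<noteq> f \<longrightarrow> ends G e \<inter> ends G f = {})"

definition perfect_matching :: "('v, 'e) multigraph \<Rightarrow> 'e set \<Rightarrow> bool" where
  "perfect_matching G M \<longleftrightarrow> matching G M \<and> (\<Union>e\<in>M. ends G e) = verts G"

text \<open>
  A cycle is given by its vertices \<open>vs\<close> and edges \<open>es\<close> in cyclic order. As usual for multigraphs,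
  a loop is a cycle of length 1 and two distinct parallel edges form a cycle of length 2.
\<close>

definition cycle :: "('v, 'e) multigraph \<Rightarrow> 'v list \<Rightarrow> 'e list \<Rightarrow> bool" where
  "cycle G vs es \<longleftrightarrow>
     vs \<noteq> [] \<and> length es = length vs \<and> distinct vs \<and> distinct es \<and>
     set vs \<subseteq> verts G \<and> set es \<subseteq> edges G \<and>
     (\<forall>i<length vs. ends G (es ! i) = {vs ! i, vs ! (Suc i mod length vs)})"

definition hamilton_cycle :: "('v, 'e) multigraph \<Rightarrow> 'v list \<Rightarrow> 'e list \<Rightarrow> bool" where
  "hamilton_cycle G vs es \<longleftrightarrow> cycle G vs es \<and> set vs = verts G"


section \<open>Venn diagrams\<close>

text \<open>
  A collection of \<open>n\<close> curves in the plane is a family \<open>c 0, \<dots>, c (n - 1)\<close> of parametrised curves;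
  the values \<open>c i\<close> for \<open>i \<ge> n\<close> are irrelevant.
\<close>

definition regions :: "nat \<Rightarrow> (nat \<Rightarrow> real \<Rightarrow> complex) \<Rightarrow> complex set set" where
  "regions n c = components (- (\<Union>i<n. path_image (c i)))"

definition venn_diagram :: "nat \<Rightarrow> (nat \<Rightarrow> real \<Rightarrow> complex) \<Rightarrow> bool" where
  "venn_diagram n c \<longleftrightarrow>
     (\<forall>i<n. simple_path (c i) \<and> pathfinish (c i) = pathstart (c i)) \<and>
     (\<forall>i<n. \<forall>j<n. i \<noteq> j \<longrightarrow> finite (path_image (c i) \<inter> path_image (c j))) \<and>
     card (regions n c) = 2 ^ n \<and>
     (\<forall>S\<subseteq>{..<n}. \<exists>!R. R \<in> regions n c \<and>
        (\<forall>i<n. R \<subseteq> (if i \<in> S then inside (path_image (c i)) else outside (path_image (c i)))))"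

definition simple_venn_diagram :: "nat \<Rightarrow> (nat \<Rightarrow> real \<Rightarrow> complex) \<Rightarrow> bool" where
  "simple_venn_diagram n c \<longleftrightarrow>
     venn_diagram n c \<and> (\<forall>p. card {i. i < n \<and> p \<in> path_image (c i)} \<le> 2)"

definition crossings :: "nat \<Rightarrow> (nat \<Rightarrow> real \<Rightarrow> complex) \<Rightarrow> complex set" where
  "crossings n c =
     {p. \<exists>i<n. \<exists>j<n. i \<noteq> j \<and> p \<in> path_image (c i) \<and> p \<in> path_image (c j)}"

text \<open>
  The segments of a curve between consecutive crossings are the open arcs into which the curve
  falls when the crossings are removed; the closure of such an arc adds exactly the one or two
  crossings at its ends. Since the open arcs of different curves are disjoint, taking edges to be
  point sets does not identify parallel edges.
\<close>

definition venn_graph :: "nat \<Rightarrow> (nat \<Rightarrow> real \<Rightarrow> complex) \<Rightarrow> (complex, complex set) multigraph" where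
  "venn_graph n c =
     \<lparr> verts = crossings n c,
       edges = (\<Union>i<n. components (path_image (c i) - crossings n c)),
       ends = (\<lambda>e. closure e \<inter> crossings n c) \<rparr>"

end

theory Submission
  imports Defs
begin

text \<open>
  All curves are graphs over the unit circle: curve \<open>i\<close> is \<open>|z| * (1 + h i (z / |z|)) = 1\<close>, the last
  one being the circle itself (\<open>h = 0\<close>, the equator). The region of \<open>S\<close> is connected as soon as the set
  of directions \<open>u\<close> with \<open>h i u < h j u\<close> for all \<open>i \<in> S\<close>, \<open>j \<notin> S\<close> is. In the angle \<open>\<theta>\<close> the waves
  are \<open>sin \<theta>\<close>, \<open>cos \<theta>\<close> and small multiples of \<open>\<bar>sin (2^(i-1) \<theta>)\<bar> * cos (2^(i-1) \<theta>)\<close>: as in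
  Edwards' construction each one crosses the equator in the middle of every arc left by its
  predecessors, but here, from \<open>i = 2\<close> on, it also touches the equator at all earlier crossings.

  So every crossing is a \<open>2^(n-1)\<close>-th root of unity, except for two points where \<open>sin\<close> meets \<open>cos\<close>,
  one outside and one inside the equator. The \<open>2^(n-2)\<close> crossings made by the newest wave, together
  with these two, form an independent set, and only \<open>2^(n-2)\<close> vertices remain. Hence there is
  neither a perfect matching nor a Hamilton cycle.
\<close>

section \<open>Star-shaped curves\<close>

text \<open>Positively homogeneous, like a Minkowski functional: the curve, its interior and its
  exterior become the sets where the gauge is equal to, below and above 1.\<close>

definition radial_gauge :: "(complex \<Rightarrow> real) \<Rightarrow> complex \<Rightarrow> real" where
  "radial_gauge f z = norm z * (1 + f (sgn z))"

text \<open>In direction \<open>u\<close> the curve has distance \<open>1 / (1 + f u)\<close> from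
  0, so larger values of \<open>f\<close> lie closer to the origin.\<close>

definition radial_curve :: "(complex \<Rightarrow> real) \<Rightarrow> real \<Rightarrow> complex" where
  "radial_curve f t = cis (2 * pi * t) / of_real (1 + f (cis (2 * pi * t)))"

lemma radial_gauge_0 [simp]: "radial_gauge f 0 = 0"
  by (simp add: radial_gauge_def)

lemma radial_gauge_of_norm_1: "norm u = 1 \<Longrightarrow> radial_gauge f u = 1 + f u"
  by (simp add: radial_gauge_def sgn_div_norm)

lemma radial_gauge_scale: "0 \<le> r \<Longrightarrow> radial_gauge f (of_real r * z) = r * radial_gauge f z"
  by (cases "r = 0") (auto simp: radial_gauge_def norm_mult sgn_mult sgn_of_real)

lemma radial_gauge_divide: "0 < r \<Longrightarrow> radial_gauge f (z / of_real r) = radial_gauge f z / r"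
  using radial_gauge_scale[of "1 / r" f z] by simp

lemma sgn_divide_of_real: "0 < r \<Longrightarrow> sgn (z / of_real r :: complex) = sgn z"
  by (simp add: sgn_divide sgn_of_real)

lemma norm_sgn_complex: "z \<noteq> 0 \<Longrightarrow> norm (sgn z :: complex) = 1"
  by (simp add: norm_sgn)

lemma sgn_norm_1: "norm z = 1 \<Longrightarrow> sgn (z::complex) = z"
  by (simp add: sgn_div_norm)

text \<open>The conclusion has the shape demanded by \<open>loop_free\<close>; \<open>sgn\<close>
  transfers it from the unit circle to every \<open>radial_curve\<close>.\<close>

lemma cis_eq_cis_cases:
  assumes "cis (2 * pi * s) = cis (2 * pi * t)" "s \<in> {0..1}" "t \<in> {0..1}"
  shows "s = t \<or> s = 0 \<and> t = 1 \<or> s = 1 \<and> t = 0"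
proof -
  have "exp (\<i> * of_real (2 * pi * s)) = exp (\<i> * of_real (2 * pi * t))"
    using assms(1) by (simp add: cis_conv_exp)
  then obtain k :: int where "\<i> * of_real (2 * pi * s) = \<i> * of_real (2 * pi * t) + (of_int (2 * k) * pi) * \<i>"
    unfolding exp_eq by auto
  then have "Im (\<i> * of_real (2 * pi * s)) = Im (\<i> * of_real (2 * pi * t) + (of_int (2 * k) * pi) * \<i>)"
    by simp
  then have "2 * pi * s = 2 * pi * t + 2 * k * pi"
    by simp
  then have "2 * pi * s = 2 * pi * (t + k)"
    by (simp add: algebra_simps)
  then have *: "s = t + k"
    by simp
  then have "\<bar>real_of_int k\<bar> \<le> 1"
    using assms by auto
  then have "k = 0 \<or> k = 1 \<or> k = -1"
    by linarith
  then show ?thesis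
    using * assms by auto
qed

lemma cis_image_unit: "cis ` (\<lambda>t. 2 * pi * t) ` {0..1} = sphere 0 1"
proof
  show "sphere 0 1 \<subseteq> cis ` (\<lambda>t. 2 * pi * t) ` {0..1}"
  proof
    fix z :: complex
    assume "z \<in> sphere 0 1"
    then have "norm z = 1"
      by simp
    then obtain t where t: "0 \<le> t" "t < 2 * pi" "z = Complex (cos t) (sin t)"
      by (rule complex_unimodular_polar)
    then have "z = cis (2 * pi * (t / (2 * pi)))" "t / (2 * pi) \<in> {0..1}"
      by (auto simp: cis.ctr)
    then show "z \<in> cis ` (\<lambda>t. 2 * pi * t) ` {0..1}"
      by blast
  qed
qed auto

text \<open>The bound 1/2 keeps \<open>1 + f u\<close> between 1/2 and 3/2, which makes the gauge
  comparable to the norm.\<close>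

locale radial =
  fixes f :: "complex \<Rightarrow> real"
  assumes cont: "continuous_on (sphere 0 1) f"
    and bound: "norm u = 1 \<Longrightarrow> \<bar>f u\<bar> \<le> 1 / 2"
begin

lemma pos: "norm u = 1 \<Longrightarrow> 1 + f u > 0"
  using bound[of u] by linarith

lemma radial_gauge_bounds: "norm z / 2 \<le> radial_gauge f z" "radial_gauge f z \<le> 2 * norm z"
proof -
  have "norm z / 2 \<le> radial_gauge f z \<and> radial_gauge f z \<le> 2 * norm z"
  proof (cases "z = 0")
    case False
    then have *: "\<bar>f (sgn z)\<bar> \<le> 1 / 2"
      by (intro bound norm_sgn_complex)
    have "norm z * (1 / 2) \<le> norm z * (1 + f (sgn z))"
      using * by (intro mult_left_mono) auto
    moreover have "norm z * (1 + f (sgn z)) \<le> norm z * 2"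
      using * by (intro mult_left_mono) auto
    ultimately show ?thesis
      by (simp add: radial_gauge_def)
  qed simp
  then show "norm z / 2 \<le> radial_gauge f z" "radial_gauge f z \<le> 2 * norm z"
    by auto
qed

text \<open>\<open>sgn\<close> is discontinuous at 0, but there the gauge is squeezed by
  \<open>2 * norm z\<close>; elsewhere it is composed of continuous maps.\<close>

lemma continuous_on_radial_gauge: "continuous_on A (radial_gauge f)"
proof -
  have "isCont (radial_gauge f) z" for z
  proof (cases "z = 0")
    case True
    have "((\<lambda>x. radial_gauge f x) \<longlongrightarrow> 0) (at 0)"
    proof (rule Lim_null_comparison)
      show "\<forall>\<^sub>F x in at 0. norm (radial_gauge f x) \<le> 2 * norm x"
      proof (intro always_eventually allI)
        show "norm (radial_gauge f x) \<le> 2 * norm x" for x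
          using radial_gauge_bounds[of x] norm_ge_zero[of x] unfolding real_norm_def by linarith
      qed
      show "((\<lambda>x::complex. 2 * norm x) \<longlongrightarrow> 0) (at 0)"
        by (auto intro!: tendsto_eq_intros)
    qed
    then show ?thesis
      using True by (simp add: isCont_def)
  next
    case False
    have "continuous_on (-{0}) (radial_gauge f)"
      unfolding radial_gauge_def
      by (intro continuous_intros continuous_on_compose2[OF cont]) (auto simp: norm_sgn split: if_splits)
    moreover have "open (- {0 :: complex})"
      by (intro open_Compl) simp
    ultimately show ?thesis
      using False by (auto simp: continuous_on_eq_continuous_at)
  qed
  then show ?thesis
    by (simp add: continuous_at_imp_continuous_on)
qed

lemma open_radial_gauge: "open {z. radial_gauge f z < r}" "open {z. radial_gauge f z > r}"
  by (auto intro!: open_Collect_less continuous_on_radial_gauge)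

lemma continuous_on_radial_curve: "continuous_on A (radial_curve f)"
  unfolding radial_curve_def
proof (intro continuous_intros continuous_on_compose2[OF cont] ballI)
  show "complex_of_real (1 + f (cis (2 * pi * t))) \<noteq> 0" for t
    using pos[OF norm_cis[of "2 * pi * t"]] unfolding of_real_eq_0_iff by auto
qed auto

lemma sgn_radial_curve: "sgn (radial_curve f t) = cis (2 * pi * t)"
  unfolding radial_curve_def by (subst sgn_divide_of_real) (simp_all add: pos)

lemma path_image_radial_curve: "path_image (radial_curve f) = {z. radial_gauge f z = 1}"
proof -
  have "radial_gauge f (radial_curve f t) = 1" for t
    using pos[OF norm_cis[of "2 * pi * t"]]
    by (simp add: radial_curve_def radial_gauge_divide radial_gauge_of_norm_1 del: of_real_add)
  moreover have "z \<in> path_image (radial_curve f)" if z: "radial_gauge f z = 1" for z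
  proof -
    have "z \<noteq> 0"
      using z by auto
    then have "sgn z \<in> sphere 0 1"
      by (simp add: norm_sgn)
    then obtain t where t: "t \<in> {0..1}" "sgn z = cis (2 * pi * t)"
      unfolding cis_image_unit[symmetric] by blast
    have "norm z = 1 / (1 + f (sgn z))"
      using z pos[of "sgn z"] \<open>z \<noteq> 0\<close> by (auto simp: radial_gauge_def norm_sgn field_simps)
    moreover have "z = sgn z * of_real (norm z)"
      using \<open>z \<noteq> 0\<close> by (simp add: sgn_div_norm scaleR_conv_of_real)
    ultimately have "z = radial_curve f t"
      unfolding radial_curve_def t(2)[symmetric] by (metis of_real_1 of_real_divide times_divide_eq_right mult.right_neutral)
    then show ?thesis
      using t by (auto simp: path_image_def)
  qed
  ultimately show ?thesis
    by (auto simp: path_image_def)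
qed

lemma simple_path_radial_curve: "simple_path (radial_curve f)"
  unfolding simple_path_def loop_free_def path_def
  using continuous_on_radial_curve cis_eq_cis_cases sgn_radial_curve by metis

lemma radial_curve_closed: "pathfinish (radial_curve f) = pathstart (radial_curve f)"
  by (simp add: pathfinish_def pathstart_def radial_curve_def)

lemma connected_radial_gauge_less: "connected {z. radial_gauge f z < 1}"
proof (rule starlike_imp_connected)
  show "starlike {z. radial_gauge f z < 1}"
    unfolding starlike_def
  proof (intro bexI[of _ 0] ballI subsetI)
    fix x z assume x: "x \<in> {z. radial_gauge f z < 1}" and "z \<in> closed_segment 0 x"
    then obtain r where r: "0 \<le> r" "r \<le> 1" "z = of_real r * x"
      by (auto simp: in_segment scaleR_conv_of_real)
    have "0 \<le> radial_gauge f x"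
      using radial_gauge_bounds(1)[of x] norm_ge_zero[of x] by linarith
    then have "r * radial_gauge f x \<le> radial_gauge f x"
      using r by (simp add: mult_left_le_one_le)
    then show "z \<in> {z. radial_gauge f z < 1}"
      using r x by (simp add: radial_gauge_scale)
  qed simp
qed

text \<open>In polar form the exterior is a continuous image of the circle times an interval,
  \<open>\<tau>\<close> being the reciprocal of the gauge.\<close>

lemma connected_radial_gauge_greater: "connected {z. radial_gauge f z > 1}"
proof -
  let ?F = "\<lambda>(u, \<tau>). u / of_real (\<tau> * (1 + f u))"
  have "connected (?F ` (sphere 0 1 \<times> {0<..<1}))"
  proof (rule connected_continuous_image)
    show "connected (sphere (0::complex) 1 \<times> {0<..<1::real})"
      by (intro connected_Times connected_sphere) auto
    show "continuous_on (sphere 0 1 \<times> {0<..<1}) ?F"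
      unfolding case_prod_beta
    proof (intro continuous_intros continuous_on_compose2[OF cont] ballI)
      fix p :: "complex \<times> real"
      assume p: "p \<in> sphere 0 1 \<times> {0<..<1}"
      then have "1 + f (fst p) > 0"
        by (intro pos) auto
      then show "complex_of_real (snd p * (1 + f (fst p))) \<noteq> 0"
        using p unfolding of_real_eq_0_iff by auto
    qed auto
  qed
  also have "?F ` (sphere 0 1 \<times> {0<..<1}) = {z. radial_gauge f z > 1}"
  proof (intro set_eqI iffI)
    fix z assume "z \<in> ?F ` (sphere 0 1 \<times> {0<..<1})"
    then obtain u \<tau> where *: "norm u = 1" "0 < \<tau>" "\<tau> < 1" "z = u / of_real (\<tau> * (1 + f u))"
      by auto
    then show "z \<in> {z. radial_gauge f z > 1}"
      using pos[of u] by (simp add: radial_gauge_divide radial_gauge_of_norm_1 del: of_real_add of_real_mult)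
  next
    fix z assume "z \<in> {z. radial_gauge f z > 1}"
    then have z: "radial_gauge f z > 1" "z \<noteq> 0"
      by auto
    then have n: "norm (sgn z) = 1"
      by (simp add: norm_sgn)
    have "1 / radial_gauge f z * (1 + f (sgn z)) = 1 / norm z"
      using z pos[OF n] by (simp add: radial_gauge_def)
    then have "z = ?F (sgn z, 1 / radial_gauge f z)"
      using z by (simp add: sgn_div_norm scaleR_conv_of_real del: of_real_add of_real_mult)
    moreover have "(sgn z, 1 / radial_gauge f z) \<in> sphere 0 1 \<times> {0<..<1}"
      using z n by auto
    ultimately show "z \<in> ?F ` (sphere 0 1 \<times> {0<..<1})"
      by blast
  qed
  finally show ?thesis .
qed

lemma components_compl_radial_curve:
  "components (- path_image (radial_curve f)) = {{z. radial_gauge f z < 1}, {z. radial_gauge f z > 1}}"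
proof (rule components_open_unique)
  show "pairwise disjnt {{z. radial_gauge f z < 1}, {z. radial_gauge f z > 1}}"
    by (auto simp: pairwise_def disjnt_def)
  show "\<Union> {{z. radial_gauge f z < 1}, {z. radial_gauge f z > 1}} = - path_image (radial_curve f)"
    unfolding path_image_radial_curve by auto
  \<comment> \<open>The gauge of 4 is at least 2 by \<open>radial_gauge_bounds\<close>.\<close>
  have "0 \<in> {z. radial_gauge f z < 1}" "4 \<in> {z. radial_gauge f z > 1}"
    using radial_gauge_bounds(1)[of 4] by auto
  then have "{z. radial_gauge f z < 1} \<noteq> {}" "{z. radial_gauge f z > 1} \<noteq> {}"
    by blast+
  then show "open X \<and> connected X \<and> X \<noteq> {}" if "X \<in> {{z. radial_gauge f z < 1}, {z. radial_gauge f z > 1}}" for X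
    using that open_radial_gauge connected_radial_gauge_less connected_radial_gauge_greater by auto
qed

lemma component_of_compl:
  assumes "z \<in> A" "A \<in> components (- path_image (radial_curve f))"
  shows "connected_component_set (- path_image (radial_curve f)) z = A"
  using assms by (metis componentsE connected_component_eq)

lemma bounded_radial_gauge_less: "bounded {z. radial_gauge f z < 1}"
  unfolding bounded_iff using radial_gauge_bounds(1) by (intro exI[of _ 2] ballI) (smt (verit) mem_Collect_eq field_sum_of_halves)

lemma unbounded_radial_gauge_greater: "\<not> bounded {z. radial_gauge f z > 1}"
proof
  assume "bounded {z. radial_gauge f z > 1}"
  then obtain B where B: "\<And>z. radial_gauge f z > 1 \<Longrightarrow> norm z \<le> B"
    unfolding bounded_iff by auto
  have "radial_gauge f (of_real (4 + \<bar>B\<bar>)) > 1"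
    using radial_gauge_bounds(1)[of "of_real (4 + \<bar>B\<bar>)"] by (simp del: of_real_add)
  from B[OF this] show False
    by (simp del: of_real_add)
qed

text \<open>The complement of the curve has just two components, and only the sublevel set is
  bounded.\<close>

lemma inside_radial_curve: "inside (path_image (radial_curve f)) = {z. radial_gauge f z < 1}"
proof (intro set_eqI)
  fix z
  consider "radial_gauge f z < 1" | "radial_gauge f z > 1" | "radial_gauge f z = 1"
    by linarith
  then show "z \<in> inside (path_image (radial_curve f)) \<longleftrightarrow> z \<in> {z. radial_gauge f z < 1}"
  proof cases
    case 1
    then show ?thesis
      using component_of_compl[of z "{z. radial_gauge f z < 1}"] bounded_radial_gauge_less components_compl_radial_curve
      by (simp add: inside_def) (simp add: path_image_radial_curve)
  next
    case 2
    then show ?thesis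
      using component_of_compl[of z "{z. radial_gauge f z > 1}"] unbounded_radial_gauge_greater components_compl_radial_curve
      by (simp add: inside_def)
  next
    case 3
    then show ?thesis
      by (simp add: inside_def path_image_radial_curve)
  qed
qed

lemma outside_radial_curve: "outside (path_image (radial_curve f)) = {z. radial_gauge f z > 1}"
  using inside_radial_curve path_image_radial_curve union_with_inside[of "path_image (radial_curve f)"]
  by (auto simp: outside_inside)

end

section \<open>Venn diagrams of star-shaped curves\<close>

text \<open>The directions whose ray from 0 meets the cell of \<open>S\<close>: it has to cross all
  curves outside \<open>S\<close> before the first curve in \<open>S\<close>.\<close>

definition sector :: "nat \<Rightarrow> (nat \<Rightarrow> complex \<Rightarrow> real) \<Rightarrow> nat set \<Rightarrow> complex set" where
  "sector n h S = {u \<in> sphere 0 1. \<forall>i\<in>S. \<forall>j\<in>{..<n} - S. h i u < h j u}"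

definition cell :: "nat \<Rightarrow> (nat \<Rightarrow> complex \<Rightarrow> real) \<Rightarrow> nat set \<Rightarrow> complex set" where
  "cell n h S = {z. \<forall>i<n. if i \<in> S then radial_gauge (h i) z < 1 else radial_gauge (h i) z > 1}"

lemma continuous_on_Max_image:
  fixes h :: "'i \<Rightarrow> 'a::topological_space \<Rightarrow> real"
  assumes "finite I" "I \<noteq> {}" "\<And>i. i \<in> I \<Longrightarrow> continuous_on A (h i)"
  shows "continuous_on A (\<lambda>u. Max ((\<lambda>i. h i u) ` I))"
  using assms by (induction I rule: finite_ne_induct) (auto intro!: continuous_on_max)

lemma continuous_on_Min_image:
  fixes h :: "'i \<Rightarrow> 'a::topological_space \<Rightarrow> real"
  assumes "finite I" "I \<noteq> {}" "\<And>i. i \<in> I \<Longrightarrow> continuous_on A (h i)"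
  shows "continuous_on A (\<lambda>u. Min ((\<lambda>i. h i u) ` I))"
  using assms by (induction I rule: finite_ne_induct) (auto intro!: continuous_on_min)

locale radial_family =
  fixes n :: nat and h :: "nat \<Rightarrow> complex \<Rightarrow> real"
  assumes n_pos: "0 < n"
    and radial: "i < n \<Longrightarrow> radial (h i)"
    and finite_eq: "i < j \<Longrightarrow> j < n \<Longrightarrow> finite {u \<in> sphere 0 1. h i u = h j u}"
    and sector: "S \<subseteq> {..<n} \<Longrightarrow> S \<noteq> {} \<Longrightarrow> S \<noteq> {..<n} \<Longrightarrow> connected (sector n h S) \<and> sector n h S \<noteq> {}"
begin

text \<open>This is the only cell containing 0, hence out of reach of the polar parametrisation used
  for the others; it is star-shaped about 0.\<close>

lemma cell_full: "connected (cell n h {..<n}) \<and> cell n h {..<n} \<noteq> {}"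
proof
  have 0: "0 \<in> cell n h {..<n}"
    by (simp add: cell_def)
  then show "cell n h {..<n} \<noteq> {}"
    by blast
  have "starlike (cell n h {..<n})"
    unfolding starlike_def
  proof (intro bexI[of _ 0] ballI subsetI 0)
    fix x z assume x: "x \<in> cell n h {..<n}" and "z \<in> closed_segment 0 x"
    then obtain r where r: "0 \<le> r" "r \<le> 1" "z = of_real r * x"
      by (auto simp: in_segment scaleR_conv_of_real)
    have "radial_gauge (h i) z < 1" if i: "i < n" for i
    proof -
      have "0 \<le> radial_gauge (h i) x"
        using radial.radial_gauge_bounds(1)[OF radial[OF i], of x] norm_ge_zero[of x] by linarith
      then have "r * radial_gauge (h i) x \<le> radial_gauge (h i) x"
        using r by (simp add: mult_left_le_one_le)
      then show ?thesis
        using r x i by (auto simp: radial_gauge_scale cell_def)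
    qed
    then show "z \<in> cell n h {..<n}"
      by (simp add: cell_def)
  qed
  then show "connected (cell n h {..<n})"
    by (rule starlike_imp_connected)
qed

lemma radial_gauge_divide_less_iff:
  assumes "norm u = 1" "0 < s" "i < n"
  shows "radial_gauge (h i) (u / of_real s) < 1 \<longleftrightarrow> h i u < s - 1"
    and "radial_gauge (h i) (u / of_real s) > 1 \<longleftrightarrow> h i u > s - 1"
  using assms by (auto simp: radial_gauge_divide radial_gauge_of_norm_1 field_simps)

text \<open>Over the direction \<open>u\<close> the cell of \<open>S\<close> is the set of all \<open>u / s\<close> with \<open>s - 1\<close> in an open
  interval \<open>{lo u<..<hi u}\<close>; so it is connected as soon as the set of directions is.\<close>

lemma cell_not_full:
  assumes S: "S \<subseteq> {..<n}" "S \<noteq> {..<n}"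
  shows "connected (cell n h S) \<and> cell n h S \<noteq> {}"
proof -
  \<comment> \<open>For empty \<open>S\<close> the cell extends to infinity, that is to
    \<open>s = 0\<close>, so the interval for \<open>s - 1\<close> starts at -1.\<close>
  define lo where "lo = (\<lambda>u. if S = {} then -1 else Max ((\<lambda>i. h i u) ` S))"
  define hi where "hi = (\<lambda>u. Min ((\<lambda>i. h i u) ` ({..<n} - S)))"
  define D where "D = sector n h S"
  define F where "F = (\<lambda>(u, \<tau>). u / complex_of_real (1 + (lo u + \<tau> * (hi u - lo u))))"
  have fin: "finite S" "finite ({..<n} - S)" and ne: "{..<n} - S \<noteq> {}"
    using S finite_subset by auto
  have D: "connected D" "D \<noteq> {}" "D \<subseteq> sphere 0 1"
  proof -
    have "connected D \<and> D \<noteq> {}"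
    proof (cases "S = {}")
      case True
      then have "D = sphere 0 1"
        by (auto simp: D_def sector_def)
      then show ?thesis
        by (auto intro!: connected_sphere)
    qed (use sector S in \<open>auto simp: D_def\<close>)
    then show "connected D" "D \<noteq> {}"
      by auto
  qed (auto simp: D_def sector_def)
  have hcont: "continuous_on D (h i)" if "i < n" for i
    using continuous_on_subset[OF radial.cont[OF radial[OF that]]] D(3) by blast
  have "continuous_on D (\<lambda>u. Max ((\<lambda>i. h i u) ` S))" if "S \<noteq> {}"
    using S that by (intro continuous_on_Max_image fin hcont) auto
  then have cont: "continuous_on D lo"
    unfolding lo_def by (cases "S = {}") auto
  have cont': "continuous_on D hi"
    unfolding hi_def by (intro continuous_on_Min_image fin ne hcont) auto
  have hb: "\<bar>h i u\<bar> < 1" if "u \<in> sphere 0 1" "i < n" for i u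
    using radial.bound[OF radial[OF that(2)], of u] that by auto
  have lo_iff: "lo u < y \<longleftrightarrow> (\<forall>i\<in>S. h i u < y)" if "u \<in> sphere 0 1" "y > -1" for u y
    using that fin by (auto simp: lo_def)
  have lo_ge: "lo u \<ge> -1" if "u \<in> sphere 0 1" for u
  proof (cases "S = {}")
    case False
    then obtain i where i: "i \<in> S" "i < n"
      using S by blast
    then have "h i u \<le> Max ((\<lambda>i. h i u) ` S)"
      using fin by (intro Max_ge) auto
    then show ?thesis
      using hb[OF that i(2)] False by (auto simp: lo_def)
  qed (simp add: lo_def)
  have hi_iff: "y < hi u \<longleftrightarrow> (\<forall>i\<in>{..<n} - S. y < h i u)" for u y
    using fin ne by (auto simp: hi_def)
  have lohi: "u \<in> D \<longleftrightarrow> u \<in> sphere 0 1 \<and> lo u < hi u" for u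
  proof (cases "u \<in> sphere 0 1")
    case True
    have "lo u < hi u \<longleftrightarrow> (\<forall>j\<in>{..<n} - S. lo u < h j u)"
      by (rule hi_iff)
    also have "\<dots> \<longleftrightarrow> (\<forall>j\<in>{..<n} - S. \<forall>i\<in>S. h i u < h j u)"
    proof (rule ball_cong[OF refl])
      fix j assume "j \<in> {..<n} - S"
      then have "h j u > -1"
        using hb[OF True, of j] by auto
      then show "lo u < h j u \<longleftrightarrow> (\<forall>i\<in>S. h i u < h j u)"
        by (rule lo_iff[OF True])
    qed
    finally show ?thesis
      using True by (auto simp: D_def sector_def)
  qed (use D in auto)
  have cell: "u / complex_of_real (1 + y) \<in> cell n h S \<longleftrightarrow> lo u < y \<and> y < hi u"
    if u: "u \<in> sphere 0 1" "y > -1" for u y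
  proof -
    have "u / complex_of_real (1 + y) \<in> cell n h S \<longleftrightarrow> (\<forall>i<n. if i \<in> S then h i u < y else h i u > y)"
      using u radial_gauge_divide_less_iff[of u "1 + y"] unfolding cell_def by (simp del: of_real_add cong: if_cong imp_cong)
    also have "\<dots> \<longleftrightarrow> (\<forall>i\<in>S. h i u < y) \<and> (\<forall>i\<in>{..<n} - S. y < h i u)"
      using S by auto
    finally show ?thesis
      using u by (simp add: lo_iff hi_iff)
  qed
  have between: "lo u < lo u + \<tau> * (hi u - lo u)" "lo u + \<tau> * (hi u - lo u) < hi u"
    if "u \<in> D" "0 < \<tau>" "\<tau> < 1" for u \<tau>
  proof -
    have d: "hi u - lo u > 0"
      using that lohi by auto
    show "lo u < lo u + \<tau> * (hi u - lo u)"
      using d that by simp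
    have "\<tau> * (hi u - lo u) < 1 * (hi u - lo u)"
      using d that by (intro mult_strict_right_mono)
    then show "lo u + \<tau> * (hi u - lo u) < hi u"
      by simp
  qed
  have "connected (F ` (D \<times> {0<..<1}))"
  proof (rule connected_continuous_image)
    show "connected (D \<times> {0<..<1::real})"
      by (intro connected_Times D) auto
    have "continuous_on (D \<times> {0<..<1}) (\<lambda>p. fst p / complex_of_real (1 + (lo (fst p) + snd p * (hi (fst p) - lo (fst p)))))"
    proof (intro continuous_intros continuous_on_compose2[OF cont] continuous_on_compose2[OF cont'] ballI)
      fix p :: "complex \<times> real"
      assume "p \<in> D \<times> {0<..<1}"
      then have "lo (fst p) + snd p * (hi (fst p) - lo (fst p)) > -1"
        using between(1)[of "fst p" "snd p"] lo_ge[of "fst p"] D(3) by fastforce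
      then show "complex_of_real (1 + (lo (fst p) + snd p * (hi (fst p) - lo (fst p)))) \<noteq> 0"
        unfolding of_real_eq_0_iff by linarith
    qed auto
    then show "continuous_on (D \<times> {0<..<1}) F"
      by (simp add: F_def case_prod_beta)
  qed
  moreover have "F ` (D \<times> {0<..<1}) \<noteq> {}"
    using D(2) by auto
  moreover have "F ` (D \<times> {0<..<1}) = cell n h S"
  proof (intro set_eqI iffI)
    fix z assume "z \<in> F ` (D \<times> {0<..<1})"
    then obtain u \<tau> where *: "u \<in> D" "0 < \<tau>" "\<tau> < 1" "z = F (u, \<tau>)"
      by auto
    moreover from * have "lo u + \<tau> * (hi u - lo u) > -1"
      using between(1)[of u \<tau>] lo_ge[of u] D(3) by fastforce
    ultimately show "z \<in> cell n h S"
      using between[of u \<tau>] cell[of u] D(3) by (auto simp: F_def simp del: of_real_add)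
  next
    fix z assume z: "z \<in> cell n h S"
    obtain i where "i < n" "i \<notin> S"
      using S by blast
    then have "radial_gauge (h i) z > 1"
      using z by (auto simp: cell_def)
    then have "z \<noteq> 0"
      by auto
    define u where "u = sgn z"
    \<comment> \<open>This inverts the parametrisation: \<open>1 + y\<close> is the reciprocal of
      the distance from 0.\<close>
    define y where "y = 1 / norm z - 1"
    have y: "y > -1" and u: "u \<in> sphere 0 1"
      using \<open>z \<noteq> 0\<close> by (auto simp: y_def u_def norm_sgn)
    have zeq: "z = u / complex_of_real (1 + y)"
      using \<open>z \<noteq> 0\<close> by (simp add: u_def y_def sgn_div_norm scaleR_conv_of_real)
    have ly: "lo u < y" "y < hi u"
      using cell[OF u y] z zeq by auto
    define \<tau> where "\<tau> = (y - lo u) / (hi u - lo u)"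
    have "0 < \<tau>" "\<tau> < 1" "lo u + \<tau> * (hi u - lo u) = y"
      using ly by (auto simp: \<tau>_def)
    moreover have "u \<in> D"
      using ly u lohi by auto
    ultimately show "z \<in> F ` (D \<times> {0<..<1})"
      using zeq by (intro image_eqI[of _ _ "(u, \<tau>)"]) (auto simp: F_def)
  qed
  ultimately show ?thesis
    by simp
qed

lemma cell_connected: "S \<subseteq> {..<n} \<Longrightarrow> connected (cell n h S)"
  and cell_nonempty: "S \<subseteq> {..<n} \<Longrightarrow> cell n h S \<noteq> {}"
  using cell_full cell_not_full by metis+

lemma cell_open: "open (cell n h S)"
proof -
  have "open {z. if i \<in> S then radial_gauge (h i) z < 1 else radial_gauge (h i) z > 1}" if "i < n" for i
    using radial.open_radial_gauge[OF radial[OF that]] by (cases "i \<in> S") auto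
  then have "open (\<Inter>i\<in>{..<n}. {z. if i \<in> S then radial_gauge (h i) z < 1 else radial_gauge (h i) z > 1})"
    by (intro open_INT) auto
  also have "(\<Inter>i\<in>{..<n}. {z. if i \<in> S then radial_gauge (h i) z < 1 else radial_gauge (h i) z > 1}) = cell n h S"
    by (auto simp: cell_def)
  finally show ?thesis .
qed

lemma cell_disjoint:
  assumes "S \<subseteq> {..<n}" "T \<subseteq> {..<n}" "z \<in> cell n h S" "z \<in> cell n h T"
  shows "S = T"
proof -
  have "i \<in> S \<longleftrightarrow> i \<in> T" if "i < n" for i
    using assms(3,4) that unfolding cell_def by (smt (verit) mem_Collect_eq)
  then show ?thesis
    using assms(1,2) by auto
qed

lemma path_image_curve: "i < n \<Longrightarrow> path_image (radial_curve (h i)) = {z. radial_gauge (h i) z = 1}"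
  by (rule radial.path_image_radial_curve[OF radial])

text \<open>A partition into nonempty connected open sets is the partition into components, and each
  point off the curves lies in the cell of the set of curves whose gauge is below 1 there.\<close>

lemma regions_eq: "regions n (\<lambda>i. radial_curve (h i)) = cell n h ` Pow {..<n}"
  unfolding regions_def
proof (rule components_open_unique)
  show "pairwise disjnt (cell n h ` Pow {..<n})"
    unfolding pairwise_def disjnt_def using cell_disjoint by blast
  show "\<Union> (cell n h ` Pow {..<n}) = - (\<Union>i<n. path_image (radial_curve (h i)))"
  proof (intro set_eqI iffI)
    fix z assume "z \<in> \<Union> (cell n h ` Pow {..<n})"
    then show "z \<in> - (\<Union>i<n. path_image (radial_curve (h i)))"
      by (auto simp: path_image_curve cell_def split: if_splits)
  next
    fix z assume z: "z \<in> - (\<Union>i<n. path_image (radial_curve (h i)))"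
    have "z \<in> cell n h {i. i < n \<and> radial_gauge (h i) z < 1}"
      using z by (force simp: path_image_curve cell_def)
    moreover have "{i. i < n \<and> radial_gauge (h i) z < 1} \<in> Pow {..<n}"
      by auto
    ultimately show "z \<in> \<Union> (cell n h ` Pow {..<n})"
      by blast
  qed
qed (use cell_open cell_connected cell_nonempty in auto)

lemma card_regions: "card (regions n (\<lambda>i. radial_curve (h i))) = 2 ^ n"
proof -
  have "inj_on (cell n h) (Pow {..<n})"
    using cell_disjoint cell_nonempty by (intro inj_onI) (metis Pow_iff ex_in_conv)
  then show ?thesis
    by (simp add: regions_eq card_image card_Pow)
qed

text \<open>Supplies existence and uniqueness of the region of \<open>S\<close> at once: the
  containments put the cell of \<open>T\<close> into that of \<open>S\<close>, and cells are
  nonempty and disjoint.\<close>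

lemma cell_subset_iff:
  assumes "S \<subseteq> {..<n}" "T \<subseteq> {..<n}"
  shows "(\<forall>i<n. cell n h T \<subseteq> (if i \<in> S then inside (path_image (radial_curve (h i)))
            else outside (path_image (radial_curve (h i))))) \<longleftrightarrow> T = S"
proof -
  have eq: "(if i \<in> S then inside (path_image (radial_curve (h i)))
       else outside (path_image (radial_curve (h i))))
     = {z. if i \<in> S then radial_gauge (h i) z < 1 else radial_gauge (h i) z > 1}" if "i < n" for i
    using that by (simp add: radial.inside_radial_curve[OF radial] radial.outside_radial_curve[OF radial])
  obtain z where "z \<in> cell n h T"
    using cell_nonempty assms by blast
  moreover have "(\<forall>i<n. cell n h T \<subseteq> {z. if i \<in> S then radial_gauge (h i) z < 1 else radial_gauge (h i) z > 1}) \<longleftrightarrow> cell n h T \<subseteq> cell n h S"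
    unfolding cell_def by blast
  ultimately show ?thesis
    using cell_disjoint[OF assms(2,1)] eq by (simp cong: imp_cong) blast
qed

text \<open>On a single curve the direction determines the point, so \<open>sgn\<close> embeds the
  intersection into the finite set of directions where the two functions agree.\<close>

lemma finite_inter:
  assumes "i < j" "j < n"
  shows "finite (path_image (radial_curve (h i)) \<inter> path_image (radial_curve (h j)))"
proof (rule finite_imageD)
  let ?A = "path_image (radial_curve (h i)) \<inter> path_image (radial_curve (h j))"
  have A: "norm z * (1 + h i (sgn z)) = 1" "norm z * (1 + h j (sgn z)) = 1" if "z \<in> ?A" for z
    using that assms by (auto simp: path_image_curve radial_gauge_def)
  then have A0: "norm z \<noteq> 0" if "z \<in> ?A" for z
    using that by fastforce
  have "sgn z \<in> {u \<in> sphere 0 1. h i u = h j u}" if "z \<in> ?A" for z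
  proof -
    have "norm z * (1 + h i (sgn z)) = norm z * (1 + h j (sgn z))"
      using A that by simp
    then show ?thesis
      using A0[OF that] by (auto simp: norm_sgn)
  qed
  then have "sgn ` ?A \<subseteq> {u \<in> sphere 0 1. h i u = h j u}"
    by blast
  then show "finite (sgn ` ?A)"
    using finite_eq[OF assms] finite_subset by blast
  show "inj_on sgn ?A"
  proof (rule inj_onI)
    fix x y assume xy: "x \<in> ?A" "y \<in> ?A" "sgn x = sgn y"
    have "norm x * (1 + h i (sgn x)) = norm y * (1 + h i (sgn x))"
      using A(1)[OF xy(1)] A(1)[OF xy(2)] xy(3) by simp
    moreover have "1 + h i (sgn x) \<noteq> 0"
      using A(1)[OF xy(1)] by force
    ultimately have "norm x = norm y"
      by simp
    then show "x = y"
      using xy(3) A0[OF xy(1)] by (simp add: sgn_div_norm)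
  qed
qed

theorem venn_diagram_radial: "venn_diagram n (\<lambda>i. radial_curve (h i))"
  unfolding venn_diagram_def
proof (intro conjI allI impI)
  fix i assume i: "i < n"
  show "simple_path (radial_curve (h i))" "pathfinish (radial_curve (h i)) = pathstart (radial_curve (h i))"
    using radial.simple_path_radial_curve[OF radial[OF i]] radial.radial_curve_closed[OF radial[OF i]] .
next
  fix i j assume "i < n" "j < n" "i \<noteq> j"
  then show "finite (path_image (radial_curve (h i)) \<inter> path_image (radial_curve (h j)))"
    using finite_inter[of i j] finite_inter[of j i] by (metis Int_commute linorder_neqE_nat)
next
  show "card (regions n (\<lambda>i. radial_curve (h i))) = 2 ^ n"
    by (rule card_regions)
next
  fix S :: "nat set" assume S: "S \<subseteq> {..<n}"
  show "\<exists>!R. R \<in> regions n (\<lambda>i. radial_curve (h i)) \<and>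
    (\<forall>i<n. R \<subseteq> (if i \<in> S then inside (path_image (radial_curve (h i))) else outside (path_image (radial_curve (h i)))))"
    unfolding regions_eq
    by (rule ex1I[of _ "cell n h S"]) (use cell_subset_iff[OF S] S in auto)
qed

end

section \<open>The waves\<close>

text \<open>The absolute value of wave \<open>i \<noteq> 1\<close> is \<open>\<bar>Im (u ^ 2 ^ i)\<bar>\<close> up to a constant, so its zeros are the
  roots of unity of order \<open>2 ^ (i + 1)\<close>.\<close>

definition wave :: "nat \<Rightarrow> complex \<Rightarrow> real" where
  "wave i u = (if i = 0 then Im u / 2 else if i = 1 then Re u / 2
     else \<bar>Im (u ^ 2 ^ (i - 1))\<bar> * Re (u ^ 2 ^ (i - 1)) / 4 ^ i)"

definition waves :: "nat \<Rightarrow> nat \<Rightarrow> complex \<Rightarrow> real" where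
  "waves n i u = (if i < n - 1 then wave i u else 0)"

lemma wave_0 [simp]: "wave 0 u = Im u / 2" and wave_1 [simp]: "wave (Suc 0) u = Re u / 2"
  by (simp_all add: wave_def)

section \<open>Decay and signs of the waves\<close>

lemma abs_Im_power2: "\<bar>Im (w ^ 2 ^ Suc i)\<bar> = 2 * \<bar>Re (w ^ 2 ^ i)\<bar> * \<bar>Im (w ^ 2 ^ i)\<bar>"
proof -
  have "w ^ 2 ^ Suc i = (w ^ 2 ^ i)\<^sup>2"
    by (simp add: power_mult[symmetric] mult.commute)
  then show ?thesis
    by (simp add: Im_power2 abs_mult)
qed

text \<open>By the double angle formula the product of imaginary and real part is half the imaginary
  part of the square, up to sign. Wave 1 is excluded, since it vanishes with
  \<open>Re u\<close>.\<close>

lemma abs_wave: "i \<noteq> 1 \<Longrightarrow> \<bar>wave i u\<bar> = \<bar>Im (u ^ 2 ^ i)\<bar> / (2 * 4 ^ i)"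
  using abs_Im_power2[of u "i - 1"] by (cases i) (auto simp: wave_def abs_mult)

lemma abs_Re_Im_power_le:
  assumes "norm u = 1"
  shows "\<bar>Re (u ^ k)\<bar> \<le> 1" "\<bar>Im (u ^ k)\<bar> \<le> 1"
  using abs_Re_le_cmod[of "u ^ k"] abs_Im_le_cmod[of "u ^ k"] assms by (auto simp: norm_power)

lemma abs_wave_le:
  assumes "norm u = 1"
  shows "\<bar>wave i u\<bar> \<le> 1 / 2"
proof (cases "i = 1")
  case True
  then show ?thesis
    using abs_Re_Im_power_le(1)[OF assms, of 1] by simp
next
  case False
  have "\<bar>Im (u ^ 2 ^ i)\<bar> / (2 * 4 ^ i) \<le> 1 / (2 * 1)"
    using abs_Re_Im_power_le(2)[OF assms] by (intro frac_le) auto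
  then show ?thesis
    using False by (simp add: abs_wave)
qed

text \<open>Doubling the angle at most doubles the imaginary part, while the denominator grows by
  the factor 4.\<close>

lemma abs_wave_Suc_le:
  assumes "norm u = 1" "i \<noteq> 1" "i \<noteq> 0"
  shows "\<bar>wave (Suc i) u\<bar> \<le> \<bar>wave i u\<bar> / 2"
proof -
  have "\<bar>Re (u ^ 2 ^ i)\<bar> * \<bar>Im (u ^ 2 ^ i)\<bar> \<le> \<bar>Im (u ^ 2 ^ i)\<bar>"
    using abs_Re_Im_power_le[OF assms(1)] by (intro mult_left_le_one_le) auto
  then show ?thesis
    using assms abs_Im_power2[of u i] by (simp add: abs_wave field_simps)
qed

text \<open>Wave 1 does not fit the pattern of the others, so waves 0 and 1 are compared with wave 2
  directly: two double angle steps bound \<open>\<bar>Im (u ^ 4)\<bar>\<close> by 4 times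
  \<open>\<bar>Im u\<bar>\<close> and 4 times \<open>\<bar>Re u\<bar>\<close>.\<close>

lemma abs_wave_2_le:
  assumes "norm u = 1" "i < 2"
  shows "\<bar>wave 2 u\<bar> \<le> \<bar>wave i u\<bar> / 2"
proof -
  have "\<bar>Im (u ^ 4)\<bar> = 2 * \<bar>Re (u\<^sup>2)\<bar> * \<bar>Im (u\<^sup>2)\<bar>" "\<bar>Im (u\<^sup>2)\<bar> = 2 * \<bar>Re u\<bar> * \<bar>Im u\<bar>"
    using abs_Im_power2[of u 1] abs_Im_power2[of u 0] by (simp_all add: numeral_eq_Suc)
  moreover have "\<bar>Re (u\<^sup>2)\<bar> * \<bar>Im (u\<^sup>2)\<bar> \<le> \<bar>Im (u\<^sup>2)\<bar>"
    using abs_Re_Im_power_le[OF assms(1)] by (intro mult_left_le_one_le) auto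
  moreover have "\<bar>Re u\<bar> * \<bar>Im u\<bar> \<le> \<bar>Im u\<bar>" "\<bar>Re u\<bar> * \<bar>Im u\<bar> \<le> \<bar>Re u\<bar>"
    using abs_Re_Im_power_le[OF assms(1), of 1] by (auto intro: mult_left_le_one_le mult_right_le_one_le)
  ultimately have "\<bar>Im (u ^ 4)\<bar> \<le> 4 * \<bar>Im u\<bar>" "\<bar>Im (u ^ 4)\<bar> \<le> 4 * \<bar>Re u\<bar>"
    by linarith+
  moreover have "i = 0 \<or> i = 1"
    using assms(2) by auto
  ultimately show ?thesis
    by (auto simp: abs_wave)
qed

text \<open>Hence waves \<open>i\<close> and \<open>j\<close> agree only where both vanish, and
  wherever wave \<open>i\<close> is nonzero its sign alone decides which of the two is
  larger.\<close>

lemma abs_wave_decay: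
  assumes "norm u = 1" "i < j" "2 \<le> j"
  shows "\<bar>wave j u\<bar> \<le> \<bar>wave i u\<bar> / 2"
proof -
  have *: "\<bar>wave j u\<bar> \<le> \<bar>wave k u\<bar>" if "k \<le> j" "2 \<le> k" for k j
    using that
  proof (induction j rule: dec_induct)
    case (step j)
    then show ?case
      using abs_wave_Suc_le[OF assms(1), of j] by auto
  qed simp
  show ?thesis
  proof (cases "i < 2")
    case True
    then show ?thesis
      using *[of 2 j] abs_wave_2_le[OF assms(1)] assms by fastforce
  next
    case False
    then show ?thesis
      using *[of "Suc i" j] abs_wave_Suc_le[OF assms(1), of i] assms by auto
  qed
qed

lemma continuous_on_wave: "continuous_on A (wave i)"
proof -
  consider "i = 0" | "i = 1" | "i \<noteq> 0" "i \<noteq> 1"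
    by blast
  then show ?thesis
    unfolding wave_def by cases (auto intro!: continuous_intros)
qed

text \<open>Treats wave 1 and the later waves alike: each is a positive multiple of
  \<open>Re (u ^ 2 ^ i)\<close> where the imaginary part does not vanish.\<close>

lemma wave_Suc_sign:
  assumes "Im (u ^ 2 ^ i) \<noteq> 0"
  shows "wave (Suc i) u > 0 \<longleftrightarrow> Re (u ^ 2 ^ i) > 0" "wave (Suc i) u < 0 \<longleftrightarrow> Re (u ^ 2 ^ i) < 0"
proof -
  obtain c where "c > 0" "wave (Suc i) u = c * Re (u ^ 2 ^ i)"
  proof (cases i)
    case 0
    then show thesis
      by (intro that[of "1 / 2"]) auto
  next
    case (Suc k)
    then show thesis
      using assms by (intro that[of "\<bar>Im (u ^ 2 ^ i)\<bar> / 4 ^ Suc i"]) (auto simp: wave_def)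
  qed
  then show "wave (Suc i) u > 0 \<longleftrightarrow> Re (u ^ 2 ^ i) > 0" "wave (Suc i) u < 0 \<longleftrightarrow> Re (u ^ 2 ^ i) < 0"
    by (auto simp: zero_less_mult_iff mult_less_0_iff)
qed

section \<open>Sign patterns of the waves and dyadic arcs\<close>

definition dyadic_arc :: "nat \<Rightarrow> int \<Rightarrow> real set" where
  "dyadic_arc t k = {of_int k * pi / 2 ^ t <..< of_int (k + 1) * pi / 2 ^ t}"

lemma dyadic_arc_iff: "\<theta> \<in> dyadic_arc t k \<longleftrightarrow> 0 < 2 ^ t * \<theta> - of_int k * pi \<and> 2 ^ t * \<theta> - of_int k * pi < pi"
  by (auto simp: dyadic_arc_def field_simps)

text \<open>Arc \<open>k\<close> is halved into the arcs \<open>2 * k\<close> and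
  \<open>2 * k + 1\<close> of the next level; both are described in the rescaled angle in which arc
  \<open>k\<close> is the interval from 0 to \<open>pi\<close>.\<close>

lemma dyadic_arc_Suc_iff:
  shows "\<theta> \<in> dyadic_arc (Suc t) (2 * k) \<longleftrightarrow> 0 < 2 ^ t * \<theta> - of_int k * pi \<and> 2 ^ t * \<theta> - of_int k * pi < pi / 2"
    and "\<theta> \<in> dyadic_arc (Suc t) (2 * k + 1) \<longleftrightarrow> pi / 2 < 2 ^ t * \<theta> - of_int k * pi \<and> 2 ^ t * \<theta> - of_int k * pi < pi"
  unfolding dyadic_arc_iff by (auto simp: algebra_simps)

definition sign_arc :: "nat \<Rightarrow> (nat \<Rightarrow> bool) \<Rightarrow> complex set" where
  "sign_arc t \<sigma> = {u \<in> sphere 0 1. \<forall>i\<le>t. if \<sigma> i then wave i u > 0 else wave i u < 0}"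

lemma sin_pos_iff:
  assumes "0 \<le> \<theta>" "\<theta> < 2 * pi"
  shows "sin \<theta> > 0 \<longleftrightarrow> 0 < \<theta> \<and> \<theta> < pi" "sin \<theta> < 0 \<longleftrightarrow> pi < \<theta>"
proof -
  consider "\<theta> = 0" | "0 < \<theta>" "\<theta> < pi" | "\<theta> = pi" | "pi < \<theta>"
    using assms by linarith
  then have "(sin \<theta> > 0 \<longleftrightarrow> 0 < \<theta> \<and> \<theta> < pi) \<and> (sin \<theta> < 0 \<longleftrightarrow> pi < \<theta>)"
    using sin_gt_zero[of \<theta>] sin_lt_zero[of \<theta>] assms by cases auto
  then show "sin \<theta> > 0 \<longleftrightarrow> 0 < \<theta> \<and> \<theta> < pi" "sin \<theta> < 0 \<longleftrightarrow> pi < \<theta>"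
    by auto
qed

lemma cos_pos_iff:
  assumes "0 < \<theta>" "\<theta> < pi"
  shows "cos \<theta> > 0 \<longleftrightarrow> \<theta> < pi / 2" "cos \<theta> < 0 \<longleftrightarrow> pi / 2 < \<theta>"
  using cos_monotone_0_pi[of \<theta> "pi / 2"] cos_monotone_0_pi[of "pi / 2" \<theta>] assms
  by (cases "\<theta> = pi / 2"; force)+

lemma sign_arc_0: "\<exists>k. sign_arc 0 \<sigma> = cis ` dyadic_arc 0 k"
proof -
  define k :: int where "k = (if \<sigma> 0 then 0 else 1)"
  have "sign_arc 0 \<sigma> = cis ` dyadic_arc 0 k"
  proof (intro set_eqI iffI)
    fix u assume "u \<in> sign_arc 0 \<sigma>"
    then have u: "norm u = 1" "if \<sigma> 0 then Im u > 0 else Im u < 0"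
      by (auto simp: sign_arc_def split: if_splits)
    obtain \<theta> where \<theta>: "0 \<le> \<theta>" "\<theta> < 2 * pi" "u = cis \<theta>"
      using complex_unimodular_polar[OF u(1)] by (metis cis.ctr)
    have "\<theta> \<in> dyadic_arc 0 k"
      using u(2) \<theta>(2) sin_pos_iff[OF \<theta>(1,2)] unfolding \<theta>(3) k_def dyadic_arc_iff
      by (simp split: if_splits)
    then show "u \<in> cis ` dyadic_arc 0 k"
      using \<theta>(3) by blast
  next
    fix u assume "u \<in> cis ` dyadic_arc 0 k"
    then obtain \<theta> where \<theta>: "\<theta> \<in> dyadic_arc 0 k" "u = cis \<theta>"
      by blast
    then show "u \<in> sign_arc 0 \<sigma>"
      unfolding sign_arc_def k_def dyadic_arc_iff
      by (simp add: sin_gt_zero sin_lt_zero split: if_splits)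
  qed
  then show ?thesis ..
qed

lemma sign_arc_Suc:
  "u \<in> sign_arc (Suc t) \<sigma> \<longleftrightarrow>
     u \<in> sign_arc t \<sigma> \<and> (if \<sigma> (Suc t) then wave (Suc t) u > 0 else wave (Suc t) u < 0)"
proof -
  have "(\<forall>i\<le>Suc t. P i) \<longleftrightarrow> (\<forall>i\<le>t. P i) \<and> P (Suc t)" for P
    by (metis le_Suc_eq)
  then show ?thesis
    unfolding sign_arc_def by simp
qed

text \<open>Inside a dyadic arc of level \<open>t\<close> the next wave changes its sign exactly at the midpoint.\<close>

lemma sign_arc_dyadic: "\<exists>k. sign_arc t \<sigma> = cis ` dyadic_arc t k"
proof (induction t)
  case 0
  show ?case
    by (rule sign_arc_0)
next
  case (Suc t)
  then obtain k where k: "sign_arc t \<sigma> = cis ` dyadic_arc t k"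
    by blast
  \<comment> \<open>\<open>e\<close> is the sign coming from the parity of \<open>k\<close>. With
    it, the power of \<open>cis \<theta>\<close> is expressed through the shifted angle
    \<open>\<phi> \<theta>\<close>, which runs from 0 to \<open>pi\<close> on the arc.\<close>
  define e where "e = cos (pi * of_int k)"
  have e: "e = 1 \<or> e = -1"
    by (simp add: e_def cos_npi_int)
  define \<phi> where "\<phi> = (\<lambda>\<theta>::real. 2 ^ t * \<theta> - of_int k * pi)"
  have trig: "Re (cis \<theta> ^ 2 ^ t) = e * cos (\<phi> \<theta>)" "Im (cis \<theta> ^ 2 ^ t) = e * sin (\<phi> \<theta>)" for \<theta>
  proof -
    have "cis \<theta> ^ 2 ^ t = cis (\<phi> \<theta> + pi * of_int k)"
      using Complex.DeMoivre[of \<theta> "2 ^ t"] by (simp add: \<phi>_def)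
    then show "Re (cis \<theta> ^ 2 ^ t) = e * cos (\<phi> \<theta>)" "Im (cis \<theta> ^ 2 ^ t) = e * sin (\<phi> \<theta>)"
      by (simp_all add: cos_add sin_add e_def sin_npi_int)
  qed
  have in_t: "\<theta> \<in> dyadic_arc t k \<longleftrightarrow> 0 < \<phi> \<theta> \<and> \<phi> \<theta> < pi" for \<theta>
    by (simp add: dyadic_arc_iff \<phi>_def)
  have in_half: "\<theta> \<in> dyadic_arc (Suc t) (2 * k) \<longleftrightarrow> 0 < \<phi> \<theta> \<and> \<phi> \<theta> < pi / 2"
    "\<theta> \<in> dyadic_arc (Suc t) (2 * k + 1) \<longleftrightarrow> pi / 2 < \<phi> \<theta> \<and> \<phi> \<theta> < pi" for \<theta>
    by (simp_all only: dyadic_arc_Suc_iff \<phi>_def)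
  \<comment> \<open>The next wave has the sign of \<open>e * cos (\<phi> \<theta>)\<close>, so it is
    positive on the left half, of index \<open>2 * k\<close>, exactly if
    \<open>e = 1\<close>.\<close>
  define k' where "k' = (if \<sigma> (Suc t) \<longleftrightarrow> e = 1 then 2 * k else 2 * k + 1)"
  have "(if \<sigma> (Suc t) then wave (Suc t) (cis \<theta>) > 0 else wave (Suc t) (cis \<theta>) < 0) \<longleftrightarrow> \<theta> \<in> dyadic_arc (Suc t) k'"
    if "\<theta> \<in> dyadic_arc t k" for \<theta>
  proof -
    have p: "0 < \<phi> \<theta>" "\<phi> \<theta> < pi"
      using that in_t by auto
    then have "Im (cis \<theta> ^ 2 ^ t) \<noteq> 0"
      using sin_gt_zero[of "\<phi> \<theta>"] e by (auto simp: trig)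
    from wave_Suc_sign[OF this] show ?thesis
      using e p cos_pos_iff[OF p] unfolding trig k'_def
      by (elim disjE) (simp_all add: in_half)
  qed
  moreover have "dyadic_arc (Suc t) k' \<subseteq> dyadic_arc t k"
  proof
    fix \<theta> assume "\<theta> \<in> dyadic_arc (Suc t) k'"
    then have "0 < \<phi> \<theta> \<and> \<phi> \<theta> < pi"
      using pi_gt_zero unfolding k'_def
      by (auto simp: in_half split: if_splits)
    then show "\<theta> \<in> dyadic_arc t k"
      using in_t by blast
  qed
  ultimately have "sign_arc (Suc t) \<sigma> = cis ` dyadic_arc (Suc t) k'"
    unfolding set_eq_iff sign_arc_Suc k by blast
  then show ?case ..
qed

lemma sign_arc_connected: "connected (sign_arc t \<sigma>) \<and> sign_arc t \<sigma> \<noteq> {}"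
proof -
  obtain k where k: "sign_arc t \<sigma> = cis ` dyadic_arc t k"
    using sign_arc_dyadic by blast
  have "of_int k * pi / 2 ^ t < of_int (k + 1) * pi / 2 ^ t"
    by (simp add: divide_strict_right_mono)
  then have "dyadic_arc t k \<noteq> {}"
    unfolding dyadic_arc_def by (simp del: of_int_add)
  moreover have "connected (cis ` dyadic_arc t k)"
    by (intro connected_continuous_image continuous_intros) (simp add: dyadic_arc_def)
  ultimately show ?thesis
    using k by simp
qed

text \<open>The intersection of two open half-planes bounded by lines through 0 is convex and misses
  0, so \<open>sgn\<close> maps it continuously onto this part of the circle.\<close>

lemma connected_circle_halfspaces:
  "connected {u \<in> sphere 0 1. inner p u < 0 \<and> inner q (u::complex) < 0}"
proof -
  let ?C = "{z. inner p z < 0} \<inter> {z. inner q z < 0}"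
  have 0: "0 \<notin> ?C"
    by simp
  have "connected (sgn ` ?C)"
    by (intro connected_continuous_image convex_connected convex_Int convex_halfspace_lt continuous_intros) auto
  also have "sgn ` ?C = {u \<in> sphere 0 1. inner p u < 0 \<and> inner q u < 0}"
  proof (intro set_eqI iffI)
    fix u assume "u \<in> sgn ` ?C"
    then obtain z where z: "inner p z < 0" "inner q z < 0" "u = sgn z"
      by auto
    then have "z \<noteq> 0"
      by auto
    then show "u \<in> {u \<in> sphere 0 1. inner p u < 0 \<and> inner q u < 0}"
      using z by (simp add: norm_sgn) (simp add: sgn_div_norm mult_pos_neg)
  next
    fix u assume "u \<in> {u \<in> sphere 0 1. inner p u < 0 \<and> inner q u < 0}"
    then show "u \<in> sgn ` ?C"
      by (intro image_eqI[of _ _ u]) (auto simp: sgn_norm_1)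
  qed
  finally show ?thesis .
qed

text \<open>The directions over which the curves in \<open>T\<close> are the ones passing below the equator (\<open>s = 1\<close>)
  or above it (\<open>s = -1\<close>) at a suitable height.\<close>

lemma wave_sector_connected:
  assumes T: "T \<subseteq> {..<N}" "T \<noteq> {}" and s: "s = 1 \<or> s = -1"
  defines "E \<equiv> {u \<in> sphere 0 1. \<forall>i\<in>T. s * wave i u < 0 \<and> (\<forall>j\<in>{..<N} - T. s * wave i u < s * wave j u)}"
  shows "connected E \<and> E \<noteq> {}"
proof -
  define t where "t = Max T"
  have fin: "finite T"
    using T finite_subset by blast
  have t: "t \<in> T" "\<And>i. i \<in> T \<Longrightarrow> i \<le> t" "t < N"
    using T fin Max_in[OF fin] unfolding t_def by auto
  have s_abs: "\<bar>s * x\<bar> = \<bar>x\<bar>" for x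
    using s by auto
  have dec: "\<bar>s * wave j u\<bar> \<le> \<bar>s * wave i u\<bar> / 2" if "norm u = 1" "i < j" "2 \<le> j" for u i j
    using abs_wave_decay[OF that] unfolding s_abs .
  have below: "s * wave i u < s * wave j u" if "norm u = 1" "i < j" "2 \<le> j" "s * wave i u < 0" for u i j
    using dec[OF that(1-3)] that(4) by linarith
  have cases_nat: "j = 0 \<or> j = 1 \<or> 2 \<le> j" for j :: nat
    by linarith
  \<comment> \<open>If \<open>T\<close> is \<open>{0}\<close> or \<open>{1}\<close>, waves 0 and 1
    have to be compared with each other, which decay does not decide; half-planes do. Otherwise the
    signs of the waves up to \<open>t\<close> suffice.\<close>
  consider "T = {0}" | "T = {1}" | "t \<ge> 2 \<or> T = {0, 1}"
  proof -
    have "T \<subseteq> {0, 1}" if "\<not> t \<ge> 2"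
    proof
      fix i assume "i \<in> T"
      then show "i \<in> {0, 1}"
        using t(2)[of i] that by auto
    qed
    moreover have "T = {0} \<or> T = {1} \<or> T = {0, 1}" if "T \<subseteq> {0, 1}"
    proof -
      have "T \<in> Pow {0, 1}"
        using that by simp
      then show ?thesis
        using T(2) by (simp add: Pow_insert insert_commute)
    qed
    ultimately show ?thesis
      using that by metis
  qed
  then show ?thesis
  proof cases
    case 1
    have "u \<in> E \<longleftrightarrow> s * Im u < 0 \<and> (1 < N \<longrightarrow> s * Im u < s * Re u)" if u: "norm u = 1" for u
    proof
      assume "s * Im u < 0 \<and> (1 < N \<longrightarrow> s * Im u < s * Re u)"
      moreover from this have "s * Im u / 2 < s * wave j u" if "j < N" "j \<noteq> 0" for j
        using below[OF u, of 0 j] that cases_nat[of j] by auto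
      ultimately show "u \<in> E"
        using u 1 by (auto simp: E_def)
    next
      assume E: "u \<in> E"
      have "s * Im u < s * Re u" if "1 < N"
      proof -
        have "1 \<in> {..<N} - T"
          using 1 that by auto
        moreover have "\<forall>j\<in>{..<N} - T. s * wave 0 u < s * wave j u"
          using E 1 by (simp add: E_def)
        ultimately have "s * wave 0 u < s * wave 1 u"
          by blast
        then show ?thesis
          by simp
      qed
      then show "s * Im u < 0 \<and> (1 < N \<longrightarrow> s * Im u < s * Re u)"
        using E 1 by (auto simp: E_def)
    qed
    then have "E = {u \<in> sphere 0 1. s * Im u < 0 \<and> (1 < N \<longrightarrow> s * Im u < s * Re u)}"
      by (auto simp: E_def)
    \<comment> \<open>For \<open>N = 1\<close> there is no wave 1 to compare with, and the second
      half-plane repeats the first.\<close>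
    also have "\<dots> = {u \<in> sphere 0 1. inner (Complex 0 s) u < 0 \<and> inner (Complex (if 1 < N then - s else 0) s) u < 0}"
      by (auto simp: inner_complex_def)
    finally have E: "E = \<dots>" .
    have "Complex 0 (- s) \<in> E"
      using s unfolding E by (auto simp: inner_complex_def cmod_def)
    then show ?thesis
      unfolding E using connected_circle_halfspaces by blast
  next
    case 2
    have "u \<in> E \<longleftrightarrow> s * Re u < 0 \<and> s * Re u < s * Im u" if u: "norm u = 1" for u
    proof
      assume "s * Re u < 0 \<and> s * Re u < s * Im u"
      moreover from this have "s * Re u / 2 < s * wave j u" if "j \<noteq> 1" for j
        using below[OF u, of 1 j] that cases_nat[of j] by auto
      ultimately show "u \<in> E"
        using u 2 by (auto simp: E_def)
    next
      assume "u \<in> E"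
      have "0 \<in> {..<N} - T"
        using 2 T by auto
      moreover have "s * wave 1 u < 0" "\<forall>j\<in>{..<N} - T. s * wave 1 u < s * wave j u"
        using \<open>u \<in> E\<close> 2 by (simp_all add: E_def)
      ultimately have "s * wave 1 u < 0" "s * wave 1 u < s * wave 0 u"
        by blast+
      then show "s * Re u < 0 \<and> s * Re u < s * Im u"
        by simp
    qed
    then have "E = {u \<in> sphere 0 1. s * Re u < 0 \<and> s * Re u < s * Im u}"
      by (auto simp: E_def)
    also have "\<dots> = {u \<in> sphere 0 1. inner (Complex s 0) u < 0 \<and> inner (Complex s (- s)) u < 0}"
      by (auto simp: inner_complex_def)
    finally have E: "E = \<dots>" .
    have "Complex (- s) 0 \<in> E"
      using s unfolding E by (auto simp: inner_complex_def cmod_def)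
    then show ?thesis
      unfolding E using connected_circle_halfspaces by blast
  next
    case 3
    have "E = sign_arc t (\<lambda>i. i \<in> T \<longleftrightarrow> s = -1)"
    proof -
      have "u \<in> E \<longleftrightarrow> (\<forall>i\<le>t. if i \<in> T then s * wave i u < 0 else s * wave i u > 0)" if u: "norm u = 1" for u
      proof
        assume E: "u \<in> E"
        \<comment> \<open>\<open>s * wave j u\<close> exceeds the negative number
          \<open>s * wave t u\<close> but has at least twice its absolute value, so it must be
          positive.\<close>
        have "s * wave j u > 0" if j: "j \<le> t" "j \<notin> T" for j
        proof -
          have "j \<noteq> t"
            using j t(1) by blast
          then have "j < t"
            using j(1) by simp
          then have "2 \<le> t"
            using 3 j t(1) cases_nat[of t] by (elim disjE) auto
          have "s * wave t u < 0" "s * wave t u < s * wave j u"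
            using E t(1,3) j by (simp_all add: E_def)
          then show ?thesis
            using dec[OF u \<open>j < t\<close> \<open>2 \<le> t\<close>] by linarith
        qed
        moreover have "s * wave i u < 0" if "i \<in> T" for i
          using E that by (simp add: E_def)
        ultimately show "\<forall>i\<le>t. if i \<in> T then s * wave i u < 0 else s * wave i u > 0"
          by simp
      next
        assume *: "\<forall>i\<le>t. if i \<in> T then s * wave i u < 0 else s * wave i u > 0"
        have neg: "s * wave i u < 0" if "i \<in> T" for i
          using *[rule_format, OF t(2)[OF that]] that by simp
        have "s * wave i u < s * wave j u" if ij: "i \<in> T" "j \<notin> T" for i j
        proof (cases "j \<le> t")
          case True
          then show ?thesis
            using *[rule_format, OF True] neg[OF ij(1)] ij by simp
        next
          \<comment> \<open>Waves later than \<open>t\<close> are too small to get below a negative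
            wave of \<open>T\<close>.\<close>
          case False
          moreover have "2 \<le> j"
            using 3 False ij cases_nat[of j] by auto
          ultimately show ?thesis
            using below[OF u, of i j] neg[OF ij(1)] t(2)[OF ij(1)] False by simp
        qed
        then show "u \<in> E"
          using neg u by (simp add: E_def)
      qed
      moreover have "(if i \<in> T then s * wave i u < 0 else s * wave i u > 0)
          \<longleftrightarrow> (if i \<in> T \<longleftrightarrow> s = -1 then wave i u > 0 else wave i u < 0)" for i u
        using s by auto
      ultimately have "u \<in> E \<longleftrightarrow> u \<in> sign_arc t (\<lambda>i. i \<in> T \<longleftrightarrow> s = -1)" if "norm u = 1" for u
        using that by (simp add: sign_arc_def)
      moreover have "E \<subseteq> sphere 0 1" "sign_arc t (\<lambda>i. i \<in> T \<longleftrightarrow> s = -1) \<subseteq> sphere 0 1"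
        unfolding E_def sign_arc_def by blast+
      ultimately show ?thesis
        by (intro subset_antisym subsetI) (metis mem_sphere_0 subsetD)+
    qed
    then show ?thesis
      using sign_arc_connected by simp
  qed
qed

lemma radial_waves: "radial (waves n i)"
proof
  show "continuous_on (sphere 0 1) (waves n i)"
    unfolding waves_def by (cases "i < n - 1") (auto intro: continuous_on_wave)
  show "\<bar>waves n i u\<bar> \<le> 1 / 2" if "norm u = 1" for u
    using abs_wave_le[OF that] by (simp add: waves_def)
qed

section \<open>Zeros and coincidences of the waves\<close>

lemma finite_roots_1: "0 < k \<Longrightarrow> finite {z::complex. z ^ k = 1}"
  using card_roots_unity_eq[of k] by (auto intro: card_ge_0_finite)

lemma unit_power2_eq_1_iff:
  assumes "norm (w::complex) = 1"
  shows "w\<^sup>2 = 1 \<longleftrightarrow> Im w = 0"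
proof
  assume "Im w = 0"
  then have "w = of_real (Re w)" "\<bar>Re w\<bar> = 1"
    using assms by (auto simp: complex_eq_iff cmod_def)
  then show "w\<^sup>2 = 1"
    by (metis of_real_1 of_real_power power2_abs power_one)
qed (auto simp: power2_eq_1_iff)

lemma wave_eq_0_iff:
  assumes "norm u = 1" "i \<noteq> 1"
  shows "wave i u = 0 \<longleftrightarrow> u ^ 2 ^ Suc i = 1"
proof -
  have "wave i u = 0 \<longleftrightarrow> Im (u ^ 2 ^ i) = 0"
    using abs_wave[OF assms(2), of u] by auto
  also have "\<dots> \<longleftrightarrow> (u ^ 2 ^ i)\<^sup>2 = 1"
    using assms(1) by (intro unit_power2_eq_1_iff[symmetric]) (simp add: norm_power)
  finally show ?thesis
    by (simp add: power_mult[symmetric] mult.commute)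
qed

lemma power_eq_1_dvd: "x ^ k = 1 \<Longrightarrow> k dvd l \<Longrightarrow> x ^ l = (1 :: complex)"
  by (auto simp: power_mult elim!: dvdE)

lemma wave_eq_0_imp_root:
  assumes u: "norm u = 1" and "wave i u = 0" "i < m"
  shows "u ^ 2 ^ m = 1"
proof -
  have "u ^ 2 ^ Suc i = 1"
  proof (cases "i = 1")
    case True
    \<comment> \<open>Wave 1 vanishes if \<open>u\<close> is purely imaginary; then
      \<open>\<i> * u\<close> is real of norm 1, and \<open>u\<close> is a fourth root of
      unity.\<close>
    have "u\<^sup>2 = - ((\<i> * u)\<^sup>2)"
      by (simp add: power_mult_distrib)
    also have "(\<i> * u)\<^sup>2 = 1"
      using assms True by (subst unit_power2_eq_1_iff) (auto simp: norm_mult)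
    finally have "(u\<^sup>2)\<^sup>2 = 1"
      by simp
    then show ?thesis
      using True by (simp flip: power_mult)
  qed (use assms wave_eq_0_iff in auto)
  moreover have "(2::nat) ^ Suc i dvd 2 ^ m"
    using assms(3) by (intro le_imp_power_dvd) simp
  ultimately show ?thesis
    by (rule power_eq_1_dvd)
qed

text \<open>By decay, a coincidence with a wave of index at least 2 or with the equator takes place
  on the equator; only waves 0 and 1 can meet elsewhere.\<close>

lemma waves_eq_cases:
  assumes u: "norm u = 1" and "i < j" "j < n" "waves n i u = waves n j u"
  shows "waves n j u = 0 \<and> u ^ 2 ^ (n - 1) = 1 \<or> i = 0 \<and> j = 1 \<and> Re u = Im u"
proof -
  have i: "i < n - 1"
    using assms by linarith
  then have wi: "waves n i u = wave i u"
    by (simp add: waves_def)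
  consider "j = n - 1" | "j < n - 1" "2 \<le> j" | "j < n - 1" "i = 0" "j = 1"
    using assms by linarith
  then show ?thesis
  proof cases
    case 1
    then have "waves n j u = 0"
      by (simp add: waves_def)
    then show ?thesis
      using wave_eq_0_imp_root[OF u _ i] wi assms(4) by simp
  next
    case 2
    then have "wave i u = wave j u"
      using assms(4) wi by (simp add: waves_def)
    moreover have "\<bar>wave j u\<bar> \<le> \<bar>wave i u\<bar> / 2"
      using abs_wave_decay[OF u] assms 2 by simp
    ultimately have "wave j u = 0"
      by simp
    then show ?thesis
      using wave_eq_0_imp_root[OF u _ 2(1)] 2(1) by (simp add: waves_def)
  next
    case 3
    then show ?thesis
      using assms(4) wi by (simp add: waves_def)
  qed
qed

text \<open>The square of \<open>u\<close> is \<open>\<i>\<close>. This makes the set of diagonal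
  directions finite.\<close>

lemma diagonal_root:
  assumes "norm u = 1" "Re u = Im u"
  shows "u ^ 8 = 1"
proof -
  have "2 * (Im u * Im u) = 1"
    using assms by (auto simp: cmod_def power2_eq_square)
  then have "u\<^sup>2 = \<i>"
    using assms by (simp add: complex_eq_iff power2_eq_square)
  have "u ^ 8 = ((u\<^sup>2)\<^sup>2)\<^sup>2"
    by (simp add: power_mult[symmetric])
  then show ?thesis
    using \<open>u\<^sup>2 = \<i>\<close> by simp
qed

text \<open>Comparison with the equator fixes signs: if \<open>S\<close> omits it, all waves in
  \<open>S\<close> are negative; if \<open>S\<close> contains it, all waves in the complement are
  positive, and the complement takes the part of \<open>S\<close> with
  \<open>s = -1\<close>.\<close>

lemma sector_waves_connected:
  assumes n: "1 < n" and S: "S \<subseteq> {..<n}" "S \<noteq> {}" "S \<noteq> {..<n}"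
  shows "connected (sector n (waves n) S) \<and> sector n (waves n) S \<noteq> {}"
proof (cases "n - 1 \<in> S")
  case False
  then have S': "S \<subseteq> {..<n - 1}"
    using S(1) by (metis One_nat_def Suc_pred lessThan_Suc n order_less_trans subset_insert zero_less_one)
  have eq: "{..<n} - S = insert (n - 1) ({..<n - 1} - S)"
    using False n by auto
  have w: "waves n i u = wave i u" if "i \<in> S" for i u
    using that S' by (auto simp: waves_def)
  have "sector n (waves n) S = {u \<in> sphere 0 1. \<forall>i\<in>S. 1 * wave i u < 0 \<and> (\<forall>j\<in>{..<n - 1} - S. 1 * wave i u < 1 * wave j u)}"
    unfolding sector_def eq by (auto simp: w) (auto simp: waves_def)
  then show ?thesis
    using wave_sector_connected[OF S' S(2), of 1] by simp
next
  case True
  define T where "T = {..<n} - S"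
  have T: "T \<subseteq> {..<n - 1}" "T \<noteq> {}"
    using True S by (auto simp: T_def order.strict_iff_order)
  have eq: "S = insert (n - 1) ({..<n - 1} - T)"
    using True S n by (auto simp: T_def)
  have w: "waves n i u = wave i u" if "i \<in> T" for i u
    using that T by (auto simp: waves_def)
  have "sector n (waves n) S = {u \<in> sphere 0 1. \<forall>i\<in>insert (n - 1) ({..<n - 1} - T). \<forall>j\<in>T. waves n i u < waves n j u}"
    unfolding sector_def T_def[symmetric] by (subst eq) (rule refl)
  also have "\<dots> = {u \<in> sphere 0 1. \<forall>i\<in>T. (-1) * wave i u < 0 \<and> (\<forall>j\<in>{..<n - 1} - T. (-1) * wave i u < (-1) * wave j u)}"
    by (auto simp: w) (auto simp: waves_def)
  finally show ?thesis
    using wave_sector_connected[OF T, of "-1"] by simp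
qed

lemma radial_family_waves:
  assumes "1 < n"
  shows "radial_family n (waves n)"
proof (rule radial_family.intro)
  fix i j assume ij: "i < j" "j < n"
  have "{u \<in> sphere 0 1. waves n i u = waves n j u} \<subseteq> {u. u ^ 2 ^ (n - 1) = 1} \<union> {u. u ^ 8 = 1}"
    using waves_eq_cases[OF _ ij] diagonal_root by auto
  then show "finite {u \<in> sphere 0 1. waves n i u = waves n j u}"
    by (rule finite_subset) (simp add: finite_roots_1)
qed (use assms radial_waves sector_waves_connected in auto)

section \<open>Large independent sets\<close>

text \<open>Every vertex of \<open>I\<close> would have its partner in \<open>S\<close>, and a
  partner shared by two vertices would put three vertices on one edge; so \<open>I\<close> would
  embed into \<open>S\<close>.\<close>

lemma no_perfect_matching:
  assumes "finite I" "finite S" "I \<inter> S = {}" "verts G = I \<union> S" "card S < card I"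
    and indep: "\<And>e. e \<in> edges G \<Longrightarrow> card (ends G e) = 2 \<Longrightarrow> \<not> ends G e \<subseteq> I"
  shows "\<not> perfect_matching G M"
proof
  assume "perfect_matching G M"
  then have M: "M \<subseteq> edges G" "\<And>e. e \<in> M \<Longrightarrow> card (ends G e) = 2"
    "\<And>e f x. e \<in> M \<Longrightarrow> f \<in> M \<Longrightarrow> x \<in> ends G e \<Longrightarrow> x \<in> ends G f \<Longrightarrow> e = f"
    "(\<Union>e\<in>M. ends G e) = I \<union> S"
    using assms(4) unfolding perfect_matching_def matching_def by (simp, simp, blast, simp)
  have "\<exists>e s. e \<in> M \<and> v \<in> ends G e \<and> s \<in> ends G e \<and> s \<in> S" if v: "v \<in> I" for v
  proof -
    obtain e where e: "e \<in> M" "v \<in> ends G e"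
      using M(4) v by blast
    then obtain s where "s \<in> ends G e" "s \<notin> I"
      using indep M(1,2) by blast
    then show ?thesis
      using e M(4) by blast
  qed
  then obtain e s where es: "\<And>v. v \<in> I \<Longrightarrow> e v \<in> M \<and> v \<in> ends G (e v) \<and> s v \<in> ends G (e v) \<and> s v \<in> S"
    by metis
  have "inj_on s I"
  proof (rule inj_onI)
    fix v w assume vw: "v \<in> I" "w \<in> I" "s v = s w"
    then have "e v = e w"
      using es M(3) by metis
    then have sub: "{v, w, s v} \<subseteq> ends G (e v)"
      using es[OF vw(1)] es[OF vw(2)] \<open>e v = e w\<close> by auto
    show "v = w"
    proof (rule ccontr)
      assume "v \<noteq> w"
      moreover have "s v \<noteq> v" "s v \<noteq> w"
        using es[OF vw(1)] vw(1,2) assms(3) by auto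
      ultimately have "card {v, w, s v} = 3"
        by simp
      moreover have "finite (ends G (e v))" "card (ends G (e v)) = 2"
        using M(2) es vw(1) by (auto intro: card_ge_0_finite)
      ultimately show False
        using card_mono[OF _ sub] by simp
    qed
  qed
  then have "card I \<le> card S"
    using es assms(2) by (intro card_inj_on_le[of s]) auto
  then show False
    using assms(5) by simp
qed

lemma Suc_mod_inj_on: "inj_on (\<lambda>i. Suc i mod m) {..<m}"
proof (rule inj_onI)
  fix i j assume "i \<in> {..<m}" "j \<in> {..<m}" "Suc i mod m = Suc j mod m"
  then show "i = j"
    by (auto simp: mod_Suc split: if_splits)
qed

text \<open>Argued directly, without passing to a matching: the cyclic successor of each vertex of
  \<open>I\<close> lies in \<open>S\<close>, and taking successors is injective.\<close>

lemma no_hamilton_cycle: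
  assumes "finite I" "finite S" "S \<noteq> {}" "I \<inter> S = {}" "verts G = I \<union> S" "card S < card I"
    and indep: "\<And>e. e \<in> edges G \<Longrightarrow> card (ends G e) = 2 \<Longrightarrow> \<not> ends G e \<subseteq> I"
  shows "\<not> hamilton_cycle G vs es"
proof
  assume "hamilton_cycle G vs es"
  then have vs: "distinct vs" "set vs = I \<union> S" "length es = length vs" "set es \<subseteq> edges G"
    "\<And>i. i < length vs \<Longrightarrow> ends G (es ! i) = {vs ! i, vs ! (Suc i mod length vs)}"
    using assms(5) unfolding hamilton_cycle_def cycle_def by auto
  define m where "m = length vs"
  have "m = card I + card S"
    using distinct_card[OF vs(1)] card_Un_disjoint[OF assms(1,2,4)] vs(2) by (simp add: m_def)
  moreover have "card S > 0"
    using assms(2,3) by (simp add: card_gt_0_iff)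
  \<comment> \<open>This rules out the cycle consisting of a loop, so consecutive vertices are
    distinct.\<close>
  ultimately have m: "m \<ge> 2"
    using assms(6) by linarith
  define next' where "next' = (\<lambda>i. Suc i mod m)"
  have step: "vs ! next' i \<in> S" if i: "i < m" "vs ! i \<in> I" for i
  proof -
    have "next' i \<noteq> i" "next' i < m"
      using m i by (auto simp: next'_def mod_Suc)
    then have "vs ! i \<noteq> vs ! next' i"
      using vs(1) i by (metis m_def nth_eq_iff_index_eq)
    then have "card (ends G (es ! i)) = 2"
      using vs(5)[of i] i by (simp add: m_def next'_def)
    moreover have "es ! i \<in> edges G"
      using vs(3,4) i by (metis m_def nth_mem subsetD)
    ultimately have "\<not> ends G (es ! i) \<subseteq> I"
      using indep by blast
    then have "vs ! next' i \<notin> I"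
      using vs(5)[of i] i by (simp add: m_def next'_def)
    moreover have "vs ! next' i \<in> I \<union> S"
      using \<open>next' i < m\<close> vs(2) by (metis m_def nth_mem)
    ultimately show ?thesis
      by blast
  qed
  define A where "A = {i. i < m \<and> vs ! i \<in> I}"
  have "I \<subseteq> nth vs ` A"
  proof
    fix v assume v: "v \<in> I"
    then have "v \<in> set vs"
      using vs(2) by blast
    then obtain i where "i < m" "vs ! i = v"
      unfolding m_def in_set_conv_nth by blast
    then show "v \<in> nth vs ` A"
      using v by (auto simp: A_def)
  qed
  moreover have "finite A"
    by (simp add: A_def)
  ultimately have "card I \<le> card A"
    by (meson card_image_le card_mono finite_imageI le_trans)
  also have "card A \<le> card S"
  proof (rule card_inj_on_le[of "\<lambda>i. vs ! next' i"])
    show "inj_on (\<lambda>i. vs ! next' i) A"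
    proof (rule inj_onI)
      fix i j assume ij: "i \<in> A" "j \<in> A" "vs ! next' i = vs ! next' j"
      have "next' i < m" "next' j < m"
        using m by (auto simp: next'_def)
      then have "next' i = next' j"
        using vs(1) ij(3) by (simp add: m_def nth_eq_iff_index_eq)
      then show "i = j"
        using Suc_mod_inj_on[of m] ij by (auto simp: next'_def A_def dest: inj_onD)
    qed
  qed (use step assms(2) in \<open>auto simp: A_def\<close>)
  finally show False
    using assms(6) by simp
qed

text \<open>A continuous function without zeros keeps one strict sign on the connected set
  \<open>e\<close>, hence one weak sign on its closure. It serves to show that two vertices are not
  the ends of one edge.\<close>

lemma component_separation:
  fixes \<phi> :: "'a::topological_space \<Rightarrow> real"
  assumes "e \<in> components X" "continuous_on UNIV \<phi>" "\<And>z. z \<in> X \<Longrightarrow> \<phi> z \<noteq> 0"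
    and p: "p \<in> closure e" "\<phi> p > 0" and q: "q \<in> closure e" "\<phi> q < 0"
  shows False
proof -
  have conn: "connected (\<phi> ` e)"
    by (intro connected_continuous_image continuous_on_subset[OF assms(2)]
        in_components_connected[OF assms(1)] subset_UNIV)
  have nz: "\<phi> z \<noteq> 0" if "z \<in> e" for z
    using assms(1,3) in_components_subset that by blast
  have "closed {z. \<phi> z \<le> 0}" "closed {z. \<phi> z \<ge> 0}"
    by (intro closed_Collect_le assms(2) continuous_on_const)+
  then have "e \<subseteq> {z. \<phi> z \<le> 0} \<Longrightarrow> \<phi> p \<le> 0" "e \<subseteq> {z. \<phi> z \<ge> 0} \<Longrightarrow> \<phi> q \<ge> 0"
    using p(1) q(1) closure_minimal by blast+
  then have "\<not> e \<subseteq> {z. \<phi> z \<le> 0}" "\<not> e \<subseteq> {z. \<phi> z \<ge> 0}"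
    using p(2) q(2) by linarith+
  then obtain x y where "x \<in> e" "\<phi> x > 0" "y \<in> e" "\<phi> y < 0"
    unfolding subset_iff mem_Collect_eq not_all not_imp not_le by blast
  then have "0 \<in> \<phi> ` e"
    using conn[unfolded connected_iff_interval, rule_format, of "\<phi> y" "\<phi> x" 0] by simp
  then show False
    using nz by auto
qed

section \<open>Roots of 1 and -1 and the angle \<open>pi / M\<close>\<close>

text \<open>These two points are the roots of -1 next to 1 on either side.\<close>

lemma cis_power_minus_1: "0 < M \<Longrightarrow> cis (pi / real M) ^ M = -1" "0 < M \<Longrightarrow> cis (- (pi / real M)) ^ M = -1"
  by (subst Complex.DeMoivre, simp add: complex_eq_iff)+

lemma unit_cos_eq_power:
  assumes "norm q = 1" "Re q = cos (pi / real M)" "0 < M"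
  shows "q ^ M = -1"
proof -
  have "(Im q)\<^sup>2 = (sin (pi / real M))\<^sup>2"
    using assms(1,2) cmod_power2[of q] by (simp add: sin_squared_eq)
  then have "Im q = sin (pi / real M) \<or> Im q = - sin (pi / real M)"
    by (simp add: power2_eq_iff)
  then have "q = cis (pi / real M) \<or> q = cis (- (pi / real M))"
    using assms(2) by (auto simp: complex_eq_iff)
  then show ?thesis
    using cis_power_minus_1[OF assms(3)] by auto
qed

text \<open>A root other than 1 has angular distance at least \<open>2 * pi / M\<close> from 1, and
  the cosine decreases on the half circle; angles beyond \<open>pi\<close> are reflected.\<close>

lemma root_Re_less:
  assumes "w ^ M = 1" "w \<noteq> 1" "0 < M"
  shows "Re w < cos (pi / real M)"
proof -
  obtain k where k: "k < M" "w = cis (2 * pi * real k / real M)"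
  proof -
    have "w \<in> (\<lambda>k. cis (2 * pi * real k / real M)) ` {..<M}"
      using Complex.bij_betw_roots_unity[OF assms(3)] assms(1) by (simp add: bij_betw_def)
    then show thesis
      using that by auto
  qed
  then have "0 < k"
    using assms(2) by (cases k) auto
  define \<theta> where "\<theta> = 2 * pi * real k / real M"
  have less: "cos x < cos (pi / real M)" if "pi / real M < x" "x \<le> pi" for x
    using that by (intro cos_monotone_0_pi) auto
  have "cos \<theta> < cos (pi / real M)"
  proof (cases "\<theta> \<le> pi")
    case True
    have "pi * 1 < pi * (2 * real k)"
      using \<open>0 < k\<close> by (intro mult_strict_left_mono) auto
    then have "pi / real M < \<theta>"
      using assms(3) by (simp add: \<theta>_def divide_strict_right_mono)
    then show ?thesis
      using True by (rule less)
  next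
    case False
    have "pi * 1 < pi * (2 * (real M - real k))"
      using k(1) by (intro mult_strict_left_mono) auto
    then have "pi / real M < 2 * pi - \<theta>"
      using assms(3) by (simp add: \<theta>_def field_simps)
    then have "cos (2 * pi - \<theta>) < cos (pi / real M)"
      using False by (intro less) auto
    then show ?thesis
      by (simp add: cos_diff)
  qed
  then show ?thesis
    by (simp add: k(2) \<theta>_def)
qed

section \<open>The Venn diagram of the waves\<close>

definition wave_curves :: "nat \<Rightarrow> nat \<Rightarrow> real \<Rightarrow> complex" where
  "wave_curves n i = radial_curve (waves n i)"

text \<open>The two points where the curves of the waves 0 and 1 meet off the equator.\<close>

definition diagonal_points :: "complex set" where
  "diagonal_points = {Complex (2 / (2 * sqrt 2 + 1)) (2 / (2 * sqrt 2 + 1)),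
     Complex (- 2 / (2 * sqrt 2 - 1)) (- 2 / (2 * sqrt 2 - 1))}"

lemma path_image_wave_curves: "path_image (wave_curves n i) = {z. radial_gauge (waves n i) z = 1}"
  unfolding wave_curves_def by (rule radial.path_image_radial_curve[OF radial_waves])

lemma path_image_nonzero: "z \<in> path_image (wave_curves n i) \<Longrightarrow> z \<noteq> 0"
  by (auto simp: path_image_wave_curves)

lemma norm_1_iff_waves_0:
  assumes "z \<in> path_image (wave_curves n i)"
  shows "norm z = 1 \<longleftrightarrow> waves n i (sgn z) = 0"
  using assms path_image_nonzero[OF assms] by (auto simp: path_image_wave_curves radial_gauge_def)

lemma waves_0_imp_unit:
  assumes "z \<in> path_image (wave_curves n i)" "waves n i (sgn z) = 0"
  shows "norm z = 1" "sgn z = z"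
  using norm_1_iff_waves_0[OF assms(1)] assms(2) by (auto simp: sgn_norm_1)

lemma waves_eq_at_crossing:
  assumes "z \<in> path_image (wave_curves n i)" "z \<in> path_image (wave_curves n j)"
  shows "waves n i (sgn z) = waves n j (sgn z)"
proof -
  have "norm z * (1 + waves n i (sgn z)) = norm z * (1 + waves n j (sgn z))"
    using assms by (simp add: path_image_wave_curves radial_gauge_def)
  then show ?thesis
    using path_image_nonzero[OF assms(1)] by simp
qed

lemma unit_in_path_image_iff:
  "norm z = 1 \<Longrightarrow> z \<in> path_image (wave_curves n i) \<longleftrightarrow> waves n i z = 0"
  by (simp add: path_image_wave_curves radial_gauge_of_norm_1)

lemma in_path_image_0_iff: "1 < n \<Longrightarrow> z \<in> path_image (wave_curves n 0) \<longleftrightarrow> norm z + Im z / 2 = 1"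
  by (cases "z = 0")
    (auto simp: path_image_wave_curves radial_gauge_def waves_def sgn_div_norm field_simps)

lemma in_path_image_1_iff: "2 < n \<Longrightarrow> z \<in> path_image (wave_curves n (Suc 0)) \<longleftrightarrow> norm z + Re z / 2 = 1"
  by (cases "z = 0")
    (auto simp: path_image_wave_curves radial_gauge_def waves_def sgn_div_norm field_simps)

text \<open>Subtracting the equations gives \<open>Re z = Im z\<close>; on this line
  \<open>sqrt 2 * \<bar>x\<bar> + x / 2 = 1\<close> has one solution of each sign.\<close>

lemma diagonal_points_iff: "z \<in> diagonal_points \<longleftrightarrow> norm z + Im z / 2 = 1 \<and> norm z + Re z / 2 = 1"
proof -
  have s: "2 * sqrt 2 + 1 > 0" "2 * sqrt 2 - 1 > (0::real)"
    using real_sqrt_gt_1_iff[of 2] by linarith+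
  have n: "norm (Complex x x) = sqrt 2 * \<bar>x\<bar>" for x
    by (simp add: cmod_def real_sqrt_mult flip: mult_2)
  have "sqrt 2 * \<bar>x\<bar> + x / 2 = 1 \<longleftrightarrow> x = 2 / (2 * sqrt 2 + 1) \<or> x = - 2 / (2 * sqrt 2 - 1)" for x
  proof (cases "x \<ge> 0")
    case True
    then have "x \<noteq> - 2 / (2 * sqrt 2 - 1)"
      using s(2) divide_neg_pos[of "-2" "2 * sqrt 2 - 1"] by auto
    moreover have "sqrt 2 * x + x / 2 = 1 \<longleftrightarrow> x * (2 * sqrt 2 + 1) = 2"
      by (auto simp: algebra_simps)
    moreover have "\<dots> \<longleftrightarrow> x = 2 / (2 * sqrt 2 + 1)"
      using s(1) by (simp add: eq_divide_eq)
    ultimately show ?thesis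
      using True by simp
  next
    case False
    then have "x \<noteq> 2 / (2 * sqrt 2 + 1)"
      using s(1) divide_pos_pos[of 2 "2 * sqrt 2 + 1"] by auto
    moreover have "sqrt 2 * (- x) + x / 2 = 1 \<longleftrightarrow> x * (2 * sqrt 2 - 1) = -2"
      by (auto simp: algebra_simps)
    moreover have "\<dots> \<longleftrightarrow> x = - 2 / (2 * sqrt 2 - 1)"
      by (subst nonzero_eq_divide_eq) (use s(2) in auto)
    ultimately show ?thesis
      using False by simp
  qed
  moreover have "norm z + Im z / 2 = 1 \<and> norm z + Re z / 2 = 1 \<longleftrightarrow>
      (\<exists>x. z = Complex x x \<and> sqrt 2 * \<bar>x\<bar> + x / 2 = 1)"
  proof
    assume *: "norm z + Im z / 2 = 1 \<and> norm z + Re z / 2 = 1"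
    then have "z = Complex (Im z) (Im z)"
      by (simp add: complex_eq_iff)
    then show "\<exists>x. z = Complex x x \<and> sqrt 2 * \<bar>x\<bar> + x / 2 = 1"
      using * n[of "Im z"] by metis
  qed (auto simp: n)
  ultimately show ?thesis
    unfolding diagonal_points_def by blast
qed

lemma diagonal_points_signs: "\<exists>p q. diagonal_points = {p, q} \<and> Im p > 0 \<and> Re p > 0 \<and> Im q < 0 \<and> Re q < 0"
proof -
  let ?p = "Complex (2 / (2 * sqrt 2 + 1)) (2 / (2 * sqrt 2 + 1))"
  let ?q = "Complex (- 2 / (2 * sqrt 2 - 1)) (- 2 / (2 * sqrt 2 - 1))"
  have "2 * sqrt 2 + 1 > 0" "2 * sqrt 2 - 1 > (0::real)"
    using real_sqrt_gt_1_iff[of 2] by linarith+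
  then have "Im ?p > 0 \<and> Re ?p > 0 \<and> Im ?q < 0 \<and> Re ?q < 0"
    by simp
  moreover have "diagonal_points = {?p, ?q}"
    by (rule diagonal_points_def)
  ultimately show ?thesis
    by blast
qed

lemma card_diagonal_points: "card diagonal_points = 2"
proof -
  obtain p q where *: "diagonal_points = {p, q}" "Im p > 0" "Im q < 0"
    using diagonal_points_signs by blast
  then have "p \<noteq> q"
    by auto
  then show ?thesis
    unfolding *(1) by simp
qed

lemma norm_diagonal_points:
  assumes "z \<in> diagonal_points"
  shows "norm z \<noteq> 1"
proof
  assume "norm z = 1"
  then have "z = 0"
    using assms unfolding diagonal_points_iff by (simp add: complex_eq_iff)
  with \<open>norm z = 1\<close> show False
    by simp
qed

section \<open>Vertices of the diagram and the curves through them\<close>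

locale wave_diagram =
  fixes n :: nat and M :: nat
  assumes n: "4 \<le> n"
  defines "M \<equiv> 2 ^ (n - 2)"
begin

lemma M_facts: "0 < M" "2 ^ (n - 1) = 2 * M" "4 dvd M"
proof -
  have "n - 1 = Suc (n - 2)"
    using n by simp
  then show "2 ^ (n - 1) = 2 * M"
    unfolding M_def by simp
  have "(2::nat) ^ 2 dvd 2 ^ (n - 2)"
    using n by (intro le_imp_power_dvd) simp
  then show "4 dvd M"
    by (simp add: M_def)
qed (simp add: M_def)

lemma root_iff: "(z::complex) ^ (2 * M) = 1 \<longleftrightarrow> z ^ M = 1 \<or> z ^ M = -1"
proof -
  have "z ^ (2 * M) = (z ^ M)\<^sup>2"
    by (subst mult.commute) (rule power_mult)
  then show ?thesis
    by (simp add: power2_eq_1_iff)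
qed

lemma root_norm:
  assumes "(z::complex) ^ (2 * M) = 1"
  shows "norm z = 1"
proof -
  have "norm z ^ (2 * M) = 1 ^ (2 * M)"
    using assms by (simp flip: norm_power)
  then show ?thesis
    using M_facts(1) by (intro power_eq_imp_eq_base[of "norm z" "2 * M" 1]) auto
qed

text \<open>The last wave, of index \<open>n - 2\<close>, vanishes at all these roots, and so does
  the equator: two curves pass through each of them.\<close>

lemma waves_outer_roots:
  assumes "norm z = 1" "z ^ (2 * M) = 1" "n - 2 \<le> i"
  shows "waves n i z = 0"
proof (cases "i = n - 2")
  case True
  have "Suc (n - 2) = n - 1"
    using n by simp
  then have "wave i z = 0"
    using True n assms(2) M_facts(2) wave_eq_0_iff[OF assms(1), of i] by simp
  then show ?thesis
    by (simp add: waves_def)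
qed (use assms(3) in \<open>simp add: waves_def\<close>)

lemma crossings_eq:
  "crossings n (wave_curves n) = {z. z ^ (2 * M) = 1} \<union> diagonal_points"
proof (intro set_eqI iffI)
  fix z assume "z \<in> crossings n (wave_curves n)"
  then obtain i j where ij: "i < j" "j < n" "z \<in> path_image (wave_curves n i)" "z \<in> path_image (wave_curves n j)"
    unfolding crossings_def mem_Collect_eq by (metis linorder_neqE_nat)
  have "z \<noteq> 0"
    using path_image_nonzero ij(3) .
  have u: "norm (sgn z) = 1"
    using \<open>z \<noteq> 0\<close> by (simp add: norm_sgn)
  have "waves n i (sgn z) = waves n j (sgn z)"
    using ij(3,4) by (rule waves_eq_at_crossing)
  from waves_eq_cases[OF u ij(1,2) this]
  show "z \<in> {z. z ^ (2 * M) = 1} \<union> diagonal_points"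
  proof
    assume "waves n j (sgn z) = 0 \<and> sgn z ^ 2 ^ (n - 1) = 1"
    then show ?thesis
      using waves_0_imp_unit[OF ij(4)] M_facts(2) by simp
  next
    assume "i = 0 \<and> j = 1 \<and> Re (sgn z) = Im (sgn z)"
    then show ?thesis
      using ij n by (simp add: diagonal_points_iff in_path_image_0_iff in_path_image_1_iff)
  qed
next
  fix z assume "z \<in> {z. z ^ (2 * M) = 1} \<union> diagonal_points"
  then show "z \<in> crossings n (wave_curves n)"
  proof
    assume "z \<in> {z. z ^ (2 * M) = 1}"
    then have "z \<in> path_image (wave_curves n (n - 2))" "z \<in> path_image (wave_curves n (n - 1))"
      using root_norm waves_outer_roots unit_in_path_image_iff by auto
    moreover have "n - 2 < n" "n - 1 < n" "n - 2 \<noteq> n - 1"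
      using n by auto
    ultimately show ?thesis
      unfolding crossings_def by blast
  next
    assume "z \<in> diagonal_points"
    then have "z \<in> path_image (wave_curves n 0)" "z \<in> path_image (wave_curves n (Suc 0))"
      using n by (auto simp: diagonal_points_iff in_path_image_0_iff in_path_image_1_iff)
    moreover have "0 < n" "Suc 0 < n" "0 \<noteq> Suc 0"
      using n by auto
    ultimately show ?thesis
      unfolding crossings_def by blast
  qed
qed

text \<open>A further curve could meet curve 0 there only on the equator, but the diagonal points
  are off it.\<close>

lemma diagonal_points_other_curves:
  assumes "z \<in> diagonal_points" "2 \<le> i" "i < n"
  shows "z \<notin> path_image (wave_curves n i)"
proof
  assume z: "z \<in> path_image (wave_curves n i)"
  have z0: "z \<in> path_image (wave_curves n 0)"
    using assms(1) n by (simp add: diagonal_points_iff in_path_image_0_iff)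
  have "z \<noteq> 0"
    using path_image_nonzero z .
  then have u: "norm (sgn z) = 1"
    by (simp add: norm_sgn)
  have "waves n 0 (sgn z) = waves n i (sgn z)"
    using z0 z by (rule waves_eq_at_crossing)
  then have "waves n i (sgn z) = 0"
    using waves_eq_cases[OF u, of 0 i] assms by auto
  then show False
    using waves_0_imp_unit(1)[OF z] norm_diagonal_points[OF assms(1)] by simp
qed

text \<open>Zeros of the earlier waves are \<open>M\<close>-th roots of 1, so the newest crossings
  lie on the last wave and the equator only.\<close>

lemma neg_roots_inner_curves:
  assumes "z ^ M = -1" "i < n - 2"
  shows "z \<notin> path_image (wave_curves n i)"
proof
  assume z: "z \<in> path_image (wave_curves n i)"
  have "norm z = 1"
    using assms(1) by (intro root_norm) (simp add: root_iff)
  moreover have "waves n i z = wave i z"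
    using assms(2) by (simp add: waves_def)
  ultimately have "z ^ M = 1"
    unfolding M_def using z assms(2) by (intro wave_eq_0_imp_root[of z i]) (auto simp: unit_in_path_image_iff)
  then show False
    using assms(1) by simp
qed

section \<open>Independence of the newest crossings and the diagonal points\<close>

definition indep :: "complex set" where
  "indep = {z. z ^ M = -1} \<union> diagonal_points"

abbreviation "old_roots \<equiv> {z::complex. z ^ M = 1}"

text \<open>Two of the newest crossings are separated by their neighbours on the equator: the functional
  \<open>Re (z * cnj p) - cos (\<pi> / M) * norm z\<close> is positive at \<open>p\<close>, negative at all other \<open>q\<close>
  with \<open>q ^ M = -1\<close>, and vanishes only in the directions of the two neighbours of \<open>p\<close>.\<close>

lemma new_crossings_separated:
  assumes e: "e \<in> components (path_image (wave_curves n i) - crossings n (wave_curves n))"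
    and i: "n - 2 \<le> i"
    and p: "p \<in> closure e" "p ^ M = -1" and q: "q \<in> closure e" "q ^ M = -1" and "p \<noteq> q"
  shows False
proof -
  define \<phi> where "\<phi> = (\<lambda>z. Re (z * cnj p) - cos (pi / real M) * norm z)"
  have np: "norm p = 1" and nq: "norm q = 1"
    using p q by (auto intro!: root_norm simp: root_iff)
  have pp: "p * cnj p = 1"
    using np complex_norm_square[of p] by simp
  have "even M"
    using M_facts(3) by (meson dvd_trans even_numeral)
  have cnj_p: "cnj p ^ M = -1"
    using p(2) by (metis complex_cnj_minus complex_cnj_one complex_cnj_power)
  show False
  proof (rule component_separation[OF e _ _ p(1) _ q(1)])
    show "continuous_on UNIV \<phi>"
      unfolding \<phi>_def by (intro continuous_intros)
    have "M > 1"
      using M_facts(1,3) by (metis One_nat_def Suc_lessI dvd_1_iff_1 numeral_eq_one_iff semiring_norm(83))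
    then have "pi / real M < pi / 1"
      by (intro divide_strict_left_mono) auto
    then have "cos (pi / real M) < cos 0"
      using \<open>M > 1\<close> by (intro cos_monotone_0_pi) auto
    then show "\<phi> p > 0"
      unfolding \<phi>_def pp np by simp
    \<comment> \<open>As \<open>p\<close> has norm 1, \<open>q * cnj p\<close> is the quotient of
      two \<open>M\<close>-th roots of -1.\<close>
    have "(q * cnj p) ^ M = 1" 
      using q(2) cnj_p by (simp add: power_mult_distrib)
    moreover have "q * cnj p \<noteq> 1"
      using pp \<open>p \<noteq> q\<close> by (metis mult.commute mult.right_neutral mult.assoc)
    ultimately show "\<phi> q < 0"
      using root_Re_less[of "q * cnj p" M] M_facts(1) nq by (simp add: \<phi>_def)
    show "\<phi> z \<noteq> 0" if z: "z \<in> path_image (wave_curves n i) - crossings n (wave_curves n)" for z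
    proof
      assume "\<phi> z = 0"
      have "z \<noteq> 0"
        using z path_image_nonzero by blast
      define u where "u = sgn z"
      have u: "norm u = 1" "z = of_real (norm z) * u"
        using \<open>z \<noteq> 0\<close> by (simp_all add: u_def norm_sgn) (simp add: sgn_div_norm scaleR_conv_of_real)
      have "\<phi> z = norm z * (Re (u * cnj p) - cos (pi / real M))"
        by (subst u(2)) (simp add: \<phi>_def norm_mult u(1) algebra_simps)
      then have "Re (u * cnj p) = cos (pi / real M)"
        using \<open>\<phi> z = 0\<close> \<open>z \<noteq> 0\<close> by simp
      \<comment> \<open>The direction \<open>u\<close> is thus an \<open>M\<close>-th root of 1,
        where curve \<open>i\<close> meets the equator; so \<open>z\<close> would be one of the
        removed crossings.\<close>
      then have "(u * cnj p) ^ M = -1"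
        using np u(1) M_facts(1) by (intro unit_cos_eq_power) (auto simp: norm_mult)
      then have "u ^ M = 1"
        using cnj_p by (simp add: power_mult_distrib)
      then have root: "u ^ (2 * M) = 1"
        by (simp add: root_iff)
      then have "sgn z = z"
        using waves_outer_roots[OF u(1) _ i] z waves_0_imp_unit(2)[of z n i] by (simp add: u_def)
      then show False
        using z root by (simp add: crossings_eq u_def)
    qed
  qed
qed

text \<open>The two points lie on opposite sides of both axes, while curve 0 meets the real axis,
  and curve 1 the imaginary axis, only at crossings.\<close>

lemma diagonal_points_separated:
  assumes e: "e \<in> components (path_image (wave_curves n i) - crossings n (wave_curves n))"
    and i: "i < 2"
    and p: "diagonal_points \<subseteq> closure e"
  shows False
proof -
  obtain p q where pq: "diagonal_points = {p, q}" "Im p > 0" "Re p > 0" "Im q < 0" "Re q < 0"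
    using diagonal_points_signs by blast
  define \<phi> where "\<phi> = (if i = 0 then Im else Re)"
  have "\<phi> p > 0" "\<phi> q < 0" "p \<in> closure e" "q \<in> closure e"
    using pq p by (auto simp: \<phi>_def)
  moreover have "continuous_on UNIV \<phi>"
    by (auto simp: \<phi>_def intro: continuous_intros)
  moreover have "\<phi> z \<noteq> 0" if z: "z \<in> path_image (wave_curves n i) - crossings n (wave_curves n)" for z
  proof
    assume "\<phi> z = 0"
    have "norm z = 1 \<and> wave i z = 0"
      using z i n \<open>\<phi> z = 0\<close> in_path_image_0_iff[of n z] in_path_image_1_iff[of n z]
      by (auto simp: \<phi>_def less_2_cases_iff split: if_splits)
    then have "z ^ 2 ^ (n - 1) = 1"
      using i n by (intro wave_eq_0_imp_root[of z i]) auto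
    then show False
      using z M_facts(2) by (simp add: crossings_eq)
  qed
  ultimately show False
    using component_separation[OF e] by blast
qed

text \<open>Below index \<open>n - 2\<close> a curve contains no newest crossing, from there on no
  diagonal point (as \<open>n\<close> is at least 4), so the two ends of an edge inside
  \<open>indep\<close> would be of one kind.\<close>

lemma edges_not_in_indep:
  assumes "e \<in> edges (venn_graph n (wave_curves n))" "card (ends (venn_graph n (wave_curves n)) e) = 2"
  shows "\<not> ends (venn_graph n (wave_curves n)) e \<subseteq> indep"
proof
  let ?E = "ends (venn_graph n (wave_curves n)) e"
  assume sub: "?E \<subseteq> indep"
  obtain i where i: "i < n" "e \<in> components (path_image (wave_curves n i) - crossings n (wave_curves n))"
    using assms(1) by (auto simp: venn_graph_def)
  obtain p q where pq: "?E = {p, q}" "p \<noteq> q"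
    using assms(2) by (auto simp: card_2_iff)
  have cl: "p \<in> closure e" "q \<in> closure e"
    using pq(1) by (auto simp: venn_graph_def)
  have "closed (path_image (wave_curves n i))"
    unfolding wave_curves_def
    by (intro closed_path_image simple_path_imp_path radial.simple_path_radial_curve radial_waves)
  moreover have "e \<subseteq> path_image (wave_curves n i)"
    using in_components_subset[OF i(2)] by blast
  ultimately have "closure e \<subseteq> path_image (wave_curves n i)"
    by (rule closure_minimal[rotated])
  then have on: "p \<in> path_image (wave_curves n i)" "q \<in> path_image (wave_curves n i)"
    using cl by auto
  have I: "p \<in> indep" "q \<in> indep"
    using sub pq(1) by auto
  show False
  proof (cases "i < n - 2")
    case True
    then have pqd: "p \<in> diagonal_points" "q \<in> diagonal_points"
      using I on neg_roots_inner_curves by (auto simp: indep_def)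
    then have "i < 2"
      using diagonal_points_other_curves on(1) i(1) by (meson not_le)
    have "finite diagonal_points"
      by (simp add: diagonal_points_def)
    then have "{p, q} = diagonal_points"
      using pqd pq(2) by (intro card_subset_eq) (auto simp: card_diagonal_points)
    moreover have "{p, q} \<subseteq> closure e"
      using cl by simp
    ultimately show False
      using diagonal_points_separated[OF i(2) \<open>i < 2\<close>] by simp
  next
    case False
    then have "p \<notin> diagonal_points" "q \<notin> diagonal_points"
      using diagonal_points_other_curves[of _ i] on i(1) n by auto
    then have "p ^ M = -1" "q ^ M = -1"
      using I by (auto simp: indep_def)
    then show False
      using new_crossings_separated[OF i(2) _ cl(1) _ cl(2)] False pq(2) by auto
  qed
qed

section \<open>Counting the vertices and conclusion\<close>

lemma verts_eq: "verts (venn_graph n (wave_curves n)) = indep \<union> old_roots"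
  by (auto simp: venn_graph_def crossings_eq indep_def root_iff)

lemma finite_diagonal_points: "finite diagonal_points"
  by (simp add: diagonal_points_def)

lemma finite_neg_roots: "finite {z::complex. z ^ M = -1}"
  using card_nth_roots[of "-1" M] M_facts(1) by (auto intro: card_ge_0_finite)

lemma finite_old_roots: "finite old_roots"
  using M_facts(1) by (rule finite_roots_1)

lemma finite_indep: "finite indep"
  by (simp add: indep_def finite_diagonal_points finite_neg_roots)

lemma root_not_diagonal: "(z::complex) ^ (2 * M) = 1 \<Longrightarrow> z \<notin> diagonal_points"
  using root_norm norm_diagonal_points by blast

lemma card_indep: "card indep = M + 2"
proof -
  have "{z. z ^ M = -1} \<inter> diagonal_points = {}"
    using root_not_diagonal by (auto simp: root_iff)
  then have "card indep = card {z::complex. z ^ M = -1} + card diagonal_points"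
    unfolding indep_def by (intro card_Un_disjoint finite_neg_roots finite_diagonal_points)
  then show ?thesis
    using card_nth_roots[of "-1" M] M_facts(1) by (simp add: card_diagonal_points)
qed

lemma card_old_roots: "card old_roots = M"
  using M_facts(1) by (rule card_roots_unity_eq)

lemma indep_disjoint: "indep \<inter> old_roots = {}"
  using root_not_diagonal by (auto simp: indep_def root_iff)

lemma even_card_verts: "even (card (verts (venn_graph n (wave_curves n))))"
  unfolding verts_eq card_Un_disjoint[OF finite_indep finite_old_roots indep_disjoint]
  by (simp add: card_indep card_old_roots)

lemma no_perfect_matching_waves: "\<not> perfect_matching (venn_graph n (wave_curves n)) E"
  using edges_not_in_indep
  by (intro no_perfect_matching[OF finite_indep finite_old_roots indep_disjoint verts_eq])
    (auto simp: card_indep card_old_roots)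

lemma no_hamilton_cycle_waves: "\<not> hamilton_cycle (venn_graph n (wave_curves n)) vs es"
proof -
  have "1 \<in> old_roots"
    by simp
  then have "old_roots \<noteq> {}"
    by blast
  then show ?thesis
    using edges_not_in_indep
    by (intro no_hamilton_cycle[OF finite_indep finite_old_roots _ indep_disjoint verts_eq])
      (auto simp: card_indep card_old_roots)
qed

lemma not_simple: "\<not> simple_venn_diagram n (wave_curves n)"
proof
  assume "simple_venn_diagram n (wave_curves n)"
  then have "card {i. i < n \<and> 1 \<in> path_image (wave_curves n i)} \<le> 2"
    by (simp add: simple_venn_diagram_def)
  \<comment> \<open>The point 1 is a zero of wave 0 and of the last wave and lies on the equator;
    these are three different curves.\<close>
  moreover have "{0, n - 2, n - 1} \<subseteq> {i. i < n \<and> 1 \<in> path_image (wave_curves n i)}"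
    using n waves_outer_roots[of 1] by (auto simp: unit_in_path_image_iff waves_def)
  then have "card {0, n - 2, n - 1} \<le> card {i. i < n \<and> 1 \<in> path_image (wave_curves n i)}"
    by (intro card_mono) auto
  moreover have "card {0, n - 2, n - 1} = 3"
    using n by (auto simp: card_insert_if)
  ultimately show False
    by simp
qed

lemma venn_diagram_waves: "venn_diagram n (wave_curves n)"
proof -
  interpret radial_family n "waves n"
    using n by (intro radial_family_waves) simp
  show ?thesis
    using venn_diagram_radial by (simp add: wave_curves_def[abs_def])
qed

end

theorem theorem7:
  fixes n :: nat
  assumes "n \<ge> 4"
  shows "\<exists>c :: nat \<Rightarrow> real \<Rightarrow> complex.
           venn_diagram n c \<and> \<not> simple_venn_diagram n c \<and>
           even (card (verts (venn_graph n c))) \<and>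
           \<not> (\<exists>M. perfect_matching (venn_graph n c) M) \<and>
           \<not> (\<exists>vs es. hamilton_cycle (venn_graph n c) vs es)"
proof -
  interpret wave_diagram n "2 ^ (n - 2)"
    by unfold_locales (use assms in simp)
  show ?thesis
    using venn_diagram_waves not_simple even_card_verts no_perfect_matching_waves no_hamilton_cycle_waves
    by blast
qed

end
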